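(* (Further cubature formulas related to $\mathcal{P}^{III,+}_k$) Let $n$ be a positive integer. (1) For any integer $N\ge2$ and any polynomial $f\in\mathbb{R}[Y_1,\dots,Y_n]$ of degree at most $2(N-1)$, $$\int_{\mathfrak{F}}f(Y)\,\omega^{III,+}(Y)\,dY=\left(\frac{1}{N}\right)^n\sum_{Y\in \mathfrak{F}_N^{\mathrm{III},+}}\mathcal{E}_Y\mathcal{H}_Y^{-1}f(Y)\,\mathcal{J}^{III,+}(Y),$$ $$\int_{\mathfrak{F}}f(Y)\,\omega^{III,+}(Y)\,dY=\left(\frac{1}{N}\right)^n\sum_{Y\in \mathfrak{F}_N^{\mathrm{IV},+}}\mathcal{H}_Y^{-1}f(Y)\,\mathcal{J}^{III,+}(Y).$$ (2) For any integer $N\ge2$ and any polynomial $f\in\mathbb{R}[Y_1,\dots,Y_n]$ of degree at most $2(N-1)-1$, $$\int_{\mathfrak{F}}f(Y)\,\omega^{III,+}(Y)\,dY=\left(\frac{2}{2N-1}\right)^n\sum_{Y\in \mathfrak{F}_N^{\mathrm{VII},+}}\mathcal{E}_Y\mathcal{H}_Y^{-1}f(Y)\,\mathcal{J}^{III,+}(Y).$$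
   Context: For $\lambda,x\in\mathbb{R}^n$: $\cos^+_\lambda(x)=\sum_{\sigma\in S_n}\prod_{i=1}^n\cos(\pi\lambda_{\sigma(i)}x_i)$. $F=\{x\in\mathbb{R}^n : 1\ge x_1\ge x_2\ge\dots\ge x_n\ge0\}$. Let $X_j(x)=\cos^+_{(1,\dots,1,0,\dots,0)}(x)$ with $j$ ones and $n-j$ zeros, $j=1,\dots,n$; let $\varphi(x)=(X_1(x),\dots,X_n(x))$ for $x\in F$ and $\mathfrak{F}=\varphi(F)$. The map $\varphi$ is injective on $F$. Let $J(x)=\det\frac{\partial(X_1,\dots,X_n)}{\partial(x_1,\dots,x_n)}$. Then $J(x)^2=p^{I,+}(\varphi(x))$ for a polynomial $p^{I,+}$; put $\mathcal{J}(Y)=\sqrt{p^{I,+}(Y)}$ for $Y\in\mathfrak{F}$ (so $\mathcal{J}(\varphi(x))=|J(x)|$ for $x\in F$). With $\rho=(\frac12,\dots,\frac12)$, the polynomial $\mathcal{J}^{III,+}$ is determined by $\mathcal{J}^{III,+}(\varphi(x))=\cos^+_{\rho}(x)^2$, and $\omega^{III,+}=\mathcal{J}^{III,+}/\mathcal{J}$. For fixed $N$: $c_r=\frac12$ if $r=0$ or $r=N$, and $c_r=1$ otherwise; $D_N^+=\{r\in\mathbb{Z}^n : N-1\ge r_1\ge\dots\ge r_n\ge0\}$. Grids: $F_N^{\mathrm{III},+}=\left\{\left(\frac{r_1}{N},\dots,\frac{r_n}{N}\right): r\in D_{N}^+\right\}$, $F_N^{\mathrm{IV},+}=\left\{\left(\frac{r_1+\frac12}{N},\dots,\frac{r_n+\frac12}{N}\right):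 r\in D_{N}^+\right\}$, $F_N^{\mathrm{VII},+}=\left\{\left(\frac{2r_1}{2N-1},\dots,\frac{2r_n}{2N-1}\right): r\in D_{N}^+\right\}$, and $\mathfrak{F}_N^{t,+}=\varphi(F_N^{t,+})$. For $Y=\varphi(s)$ with $s$ the grid point labeled by $r$: $\mathcal{H}_Y=H_s=\#\{\sigma\in S_n : (s_{\sigma(1)},\dots,s_{\sigma(n)})=s\}$ and $\mathcal{E}_Y=c_{r_1}\cdots c_{r_n}$ (grids III and VII). *)

theory Defs
  imports "HOL-Analysis.Analysis" "HOL-Library.Poly_Mapping"
begin

text \<open>
  The index set \<open>{1,\<dots>,n}\<close> is an arbitrary finite well-ordered type \<open>'n\<close> (so \<open>n = CARD('n) \<ge> 1\<close>,
  and every such \<open>n\<close> occurs, up to order isomorphism exactly once).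
  The order of \<open>'n\<close> is the order of the coordinates.
\<close>

type_synonym 'n rpoly = "('n \<Rightarrow>\<^sub>0 nat) \<Rightarrow>\<^sub>0 real"

definition rpoly_eval :: "('n::finite) rpoly \<Rightarrow> real^'n \<Rightarrow> real" where
  "rpoly_eval p Y =
     (\<Sum>m\<in>Poly_Mapping.keys p. Poly_Mapping.lookup p m *
        (\<Prod>i\<in>UNIV. (Y $ i) ^ Poly_Mapping.lookup m i))"

text \<open>Total degree, with the convention that the zero polynomial has degree \<open>0\<close>.\<close>

definition rpoly_degree :: "('n::finite) rpoly \<Rightarrow> nat" where
  "rpoly_degree p =
     Max (insert 0 ((\<lambda>m. \<Sum>i\<in>UNIV. Poly_Mapping.lookup m i) ` Poly_Mapping.keys p))"

definition cos_plus :: "real^'n \<Rightarrow> real^'n \<Rightarrow> real" where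
  "cos_plus l x = (\<Sum>\<sigma> | \<sigma> permutes (UNIV::'n::finite set). \<Prod>i\<in>UNIV. cos (pi * l $ \<sigma> i * x $ i))"

definition fund_dom :: "(real^'n::{finite,wellorder}) set" where
  "fund_dom = {x. (\<forall>i. 0 \<le> x $ i \<and> x $ i \<le> 1) \<and> (\<forall>i j. i \<le> j \<longrightarrow> x $ j \<le> x $ i)}"

text \<open>If \<open>j\<close> is the \<open>k\<close>-th element of \<open>'n\<close>, the label below consists of \<open>k\<close> ones followed by
  \<open>n - k\<close> zeros.\<close>

definition X_var :: "'n::{finite,wellorder} \<Rightarrow> real^'n::_ \<Rightarrow> real" where
  "X_var j x = cos_plus (\<chi> i. if i \<le> j then 1 else 0) x"

definition phi :: "real^'n::{finite,wellorder} \<Rightarrow> real^'n::_" where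
  "phi x = (\<chi> j. X_var j x)"

definition phi_dom :: "(real^'n::{finite,wellorder}) set" where
  "phi_dom = phi ` fund_dom"

definition jac_det :: "real^'n::{finite,wellorder} \<Rightarrow> real" where
  "jac_det x = det (jacobian phi (at x))"

text \<open>The polynomials \<open>p\<^sup>I\<^sup>,\<^sup>+\<close> and \<open>\<J>\<^sup>I\<^sup>I\<^sup>I\<^sup>,\<^sup>+\<close>. The defining equations fix their values on \<open>phi_dom\<close>,
  which is the only place where they are evaluated below.\<close>

definition p_I :: "('n::{finite,wellorder}) rpoly" where
  "p_I = (SOME p. \<forall>x\<in>fund_dom. rpoly_eval p (phi x) = (jac_det x)\<^sup>2)"

definition J_III :: "('n::{finite,wellorder}) rpoly" where
  "J_III = (SOME p. \<forall>x\<in>fund_dom. rpoly_eval p (phi x) = (cos_plus (\<chi> i. 1 / 2) x)\<^sup>2)"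

definition cal_J :: "real^'n::{finite,wellorder} \<Rightarrow> real" where
  "cal_J Y = sqrt (rpoly_eval p_I Y)"

text \<open>On the part of \<open>phi_dom\<close> where \<open>cal_J\<close> vanishes, \<open>omega_III\<close> takes the value \<open>0\<close>,
  as \<open>x / 0 = 0\<close>. This part is a null set.\<close>

definition omega_III :: "real^'n::{finite,wellorder} \<Rightarrow> real" where
  "omega_III Y = rpoly_eval J_III Y / cal_J Y"

definition c_weight :: "int \<Rightarrow> int \<Rightarrow> real" where
  "c_weight N r = (if r = 0 \<or> r = N then 1 / 2 else 1)"

definition D_plus :: "int \<Rightarrow> (int^'n::{finite,wellorder}) set" where
  "D_plus N = {r. (\<forall>i. 0 \<le> r $ i \<and> r $ i \<le> N - 1) \<and> (\<forall>i j. i \<le> j \<longrightarrow> r $ j \<le> r $ i)}"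

definition pt_III :: "int \<Rightarrow> int^'n \<Rightarrow> real^'n" where
  "pt_III N r = (\<chi> i. real_of_int (r $ i) / real_of_int N)"

definition pt_IV :: "int \<Rightarrow> int^'n \<Rightarrow> real^'n" where
  "pt_IV N r = (\<chi> i. (real_of_int (r $ i) + 1 / 2) / real_of_int N)"

definition pt_VII :: "int \<Rightarrow> int^'n \<Rightarrow> real^'n" where
  "pt_VII N r = (\<chi> i. 2 * real_of_int (r $ i) / (2 * real_of_int N - 1))"

text \<open>The grids in \<open>fund_dom\<close> and their images; \<open>pt\<close> is one of \<open>pt_III\<close>, \<open>pt_IV\<close>, \<open>pt_VII\<close>.\<close>

definition grid :: "(int \<Rightarrow> int^'n::_ \<Rightarrow> real^'n::_) \<Rightarrow> int \<Rightarrow> (real^'n::{finite,wellorder}) set" where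
  "grid pt N = pt N ` D_plus N"

definition phi_grid :: "(int \<Rightarrow> int^'n::_ \<Rightarrow> real^'n::_) \<Rightarrow> int \<Rightarrow> (real^'n::{finite,wellorder}) set" where
  "phi_grid pt N = phi ` grid pt N"

definition stab_card :: "real^'n::finite \<Rightarrow> nat" where
  "stab_card s = card {\<sigma>. \<sigma> permutes (UNIV::'n set) \<and> (\<chi> i. s $ \<sigma> i) = s}"

text \<open>Since \<open>phi\<close> is injective on \<open>fund_dom\<close>, a grid point \<open>Y = phi (pt N r)\<close> determines both
  \<open>s = pt N r\<close> and its label \<open>r\<close>.\<close>

definition H_coeff :: "real^'n::{finite,wellorder} \<Rightarrow> real" where
  "H_coeff Y = real (stab_card (the_inv_into fund_dom phi Y))"

definition E_coeff :: "(int \<Rightarrow> int^'n::_ \<Rightarrow> real^'n::_) \<Rightarrow> int \<Rightarrow> real^'n::{finite,wellorder} \<Rightarrow> real" where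
  "E_coeff pt N Y =
     (\<Prod>i\<in>UNIV. c_weight N (the_inv_into (D_plus N) (\<lambda>r. phi (pt N r)) Y $ i))"

end

theory Submission
  imports Defs
begin

text \<open>
  Write \<open>c_i = cos (\<pi> x_i)\<close>. The functions \<open>X_j\<close> are positive multiples of the elementary symmetric
  polynomials of the \<open>c_i\<close> (\<open>X_var_esym\<close>), and \<open>cos_plus (1/2, \<dots>, 1/2)\<close> has the square
  \<open>(n!)\<^sup>2 \<Prod>\<^sub>i (1 + c_i) / 2\<close> (\<open>cos_rho_square\<close>). After the substitution \<open>Y = phi x\<close> the Jacobian cancels the denominator
  of \<open>omega_III\<close>, and the integral becomes the integral over \<open>fund_dom\<close> of the trigonometric polynomial
  \<open>G x = f (phi x) (n!)\<^sup>2 \<Prod>\<^sub>i (1 + c_i) / 2\<close> (\<open>integral_phi_dom\<close>). This uses that \<open>phi\<close> is injective on \<open>fund_dom\<close>, that its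
  Jacobian vanishes there only on a null set, and that both \<open>jac_det\<^sup>2\<close> (\<open>phi_poly_jac_det_square\<close>, via
  Newton's identities) and the square above (\<open>phi_poly_cos_rho_square\<close>) are polynomials in \<open>phi\<close>, so that the choice operators in the
  definitions of \<open>p_I\<close> and \<open>J_III\<close> have witnesses.

  The function \<open>G\<close> is symmetric. Hence its integral over \<open>fund_dom\<close> is \<open>1/n!\<close> times the one over the unit cube,
  and likewise the sum over the decreasing labels with weights \<open>1 / stab_card\<close> is \<open>1/n!\<close> times the sum over
  all labels (\<open>integral_cube_symmetric\<close>, \<open>sum_labels_symmetric\<close>). On the cube everything factors: every
  \<open>X_j\<close> has degree one in each \<open>c_i\<close>, so \<open>G\<close> is a combination of products of the functions \<open>c_i\<^sup>m (1 + c_i)\<close>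
  with \<open>m\<close> at most the degree of \<open>f\<close>, and it suffices that the one-dimensional rules are exact for these
  (\<open>product_quadrature\<close>). The rules of types III and IV are exact for the cosines of frequency up to
  \<open>2 N - 1\<close>, the rule of type VII up to \<open>2 N - 2\<close>; subtracting one for the factor \<open>1 + c_i\<close> gives the two
  degree bounds of the theorem.
\<close>

section \<open>Polynomial functions with a bound on every partial degree\<close>

text \<open>
  The linear span of the monomials whose exponents are all at most \<open>d\<close>. A product quadrature rule
  is exact for a monomial as soon as its one-dimensional factors are exact for each exponent
  separately, so this bound, rather than the total degree, is what exactness depends on. In the
  inductive form an identity between linear functionals only has to be checked on monomials.
\<close>

inductive coord_poly :: "nat \<Rightarrow> (real^'n::finite \<Rightarrow> real) \<Rightarrow> bool" for d where
  coord_poly_monom: "(\<And>i. m i \<le> d) \<Longrightarrow> coord_poly d (\<lambda>y. a * (\<Prod>i\<in>UNIV. y $ i ^ m i))"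
| coord_poly_add: "coord_poly d g \<Longrightarrow> coord_poly d h \<Longrightarrow> coord_poly d (\<lambda>y. g y + h y)"

lemma coord_poly_mono: "coord_poly d h \<Longrightarrow> d \<le> e \<Longrightarrow> coord_poly e h"
  by (induction rule: coord_poly.induct) (auto intro: coord_poly.intros le_trans)

lemma coord_poly_const: "coord_poly d (\<lambda>y. a)"
  using coord_poly_monom[of "\<lambda>_. 0" d a] by simp

lemma coord_poly_coord: "coord_poly 1 (\<lambda>y. y $ i)"
proof -
  have "(\<lambda>y::real^'a. 1 * (\<Prod>j\<in>UNIV. y $ j ^ (if j = i then 1 else 0))) = (\<lambda>y. y $ i)"
  proof
    fix y :: "real^'a"
    have "(\<Prod>j\<in>UNIV. y $ j ^ (if j = i then 1 else 0)) = (\<Prod>j\<in>UNIV. if j = i then y $ j else 1)"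
      by (intro prod.cong) auto
    then show "1 * (\<Prod>j\<in>UNIV. y $ j ^ (if j = i then 1 else 0)) = y $ i"
      by simp
  qed
  then show ?thesis
    using coord_poly_monom[of "\<lambda>j. if j = i then 1 else 0" 1 1] by simp
qed

lemma coord_poly_mult_monom:
  assumes "coord_poly d h" "\<And>i. m i \<le> e"
  shows "coord_poly (d + e) (\<lambda>y. h y * (a * (\<Prod>i\<in>UNIV. y $ i ^ m i)))"
  using assms(1)
proof (induction rule: coord_poly.induct)
  case (coord_poly_monom m' b)
  have "(\<lambda>y::real^'a. b * (\<Prod>i\<in>UNIV. y $ i ^ m' i) * (a * (\<Prod>i\<in>UNIV. y $ i ^ m i)))
      = (\<lambda>y. (b * a) * (\<Prod>i\<in>UNIV. y $ i ^ (m' i + m i)))"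
    by (simp add: power_add prod.distrib mult_ac)
  then show ?case
    using coord_poly.coord_poly_monom[of "\<lambda>i. m' i + m i" "d + e" "b * a"]
      coord_poly_monom assms(2) by (simp add: add_mono)
next
  case (coord_poly_add g h)
  then show ?case
    by (simp add: distrib_right coord_poly.coord_poly_add)
qed

lemma coord_poly_mult:
  assumes "coord_poly d g" "coord_poly e h"
  shows "coord_poly (d + e) (\<lambda>y. g y * h y)"
  using assms(2)
proof (induction rule: coord_poly.induct)
  case (coord_poly_monom m a)
  then show ?case using coord_poly_mult_monom[OF assms(1)] by blast
next
  case (coord_poly_add h k)
  then show ?case
    by (simp add: distrib_left coord_poly.coord_poly_add)
qed

lemma coord_poly_sum:
  "(\<And>i. i \<in> A \<Longrightarrow> coord_poly d (h i)) \<Longrightarrow> coord_poly d (\<lambda>y. \<Sum>i\<in>A. h i y)"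
  by (induction A rule: infinite_finite_induct) (auto intro: coord_poly_const coord_poly_add)

lemma coord_poly_prod:
  assumes "finite A" "\<And>i. i \<in> A \<Longrightarrow> coord_poly (d i) (h i)"
  shows "coord_poly (\<Sum>i\<in>A. d i) (\<lambda>y. \<Prod>i\<in>A. h i y)"
  using assms by induction (auto intro: coord_poly_const coord_poly_mult)

lemma coord_poly_power: "coord_poly d h \<Longrightarrow> coord_poly (k * d) (\<lambda>y. h y ^ k)"
  by (induction k) (auto intro: coord_poly_const coord_poly_mult)

lemma rpoly_eval_superset:
  assumes "finite K" "Poly_Mapping.keys p \<subseteq> K"
  shows "rpoly_eval p Y = (\<Sum>m\<in>K. Poly_Mapping.lookup p m * (\<Prod>i\<in>UNIV. (Y $ i) ^ Poly_Mapping.lookup m i))"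
  unfolding rpoly_eval_def using assms
  by (intro sum.mono_neutral_left) (auto simp: in_keys_iff)

lemma rpoly_eval_add: "rpoly_eval (p + q) Y = rpoly_eval p Y + rpoly_eval q Y"
proof -
  let ?K = "Poly_Mapping.keys p \<union> Poly_Mapping.keys q"
  have "rpoly_eval r Y = (\<Sum>m\<in>?K. Poly_Mapping.lookup r m * (\<Prod>i\<in>UNIV. (Y $ i) ^ Poly_Mapping.lookup m i))"
    if "r \<in> {p, q, p + q}" for r
    using that keys_add[of p q] by (intro rpoly_eval_superset) auto
  then show ?thesis
    by (simp add: lookup_add distrib_right sum.distrib)
qed

lemma rpoly_eval_single:
  "rpoly_eval (Poly_Mapping.single m a) Y = a * (\<Prod>i\<in>UNIV. (Y $ i) ^ Poly_Mapping.lookup m i)"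
  by (subst rpoly_eval_superset[of "{m}"]) auto

lemma coord_poly_imp_rpoly: "coord_poly d h \<Longrightarrow> \<exists>p. \<forall>Y. rpoly_eval p Y = h Y"
proof (induction rule: coord_poly.induct)
  case (coord_poly_monom m a)
  have "Poly_Mapping.lookup (Abs_poly_mapping m) = m"
    by (simp add: Abs_poly_mapping_inverse)
  then show ?case
    by (metis rpoly_eval_single)
next
  case (coord_poly_add g h)
  then show ?case by (metis rpoly_eval_add)
qed

lemma lookup_sum_le_degree:
  assumes "m \<in> Poly_Mapping.keys p"
  shows "(\<Sum>i\<in>UNIV. Poly_Mapping.lookup m i) \<le> rpoly_degree p"
  unfolding rpoly_degree_def using assms by (intro Max_ge) auto

text \<open>
  The total degree of \<open>p\<close> turns into a bound on each partial degree, since every inner function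
  contributes at most one power of each coordinate.
\<close>

lemma coord_poly_rpoly_comp:
  assumes "\<And>j. coord_poly 1 (\<lambda>y. w y $ j)"
  shows "coord_poly (rpoly_degree p) (\<lambda>y. rpoly_eval p (w y))"
  unfolding rpoly_eval_def
proof (rule coord_poly_sum)
  fix m assume m: "m \<in> Poly_Mapping.keys p"
  have "coord_poly (Poly_Mapping.lookup m i) (\<lambda>y. (w y $ i) ^ Poly_Mapping.lookup m i)" for i
    using coord_poly_power[OF assms, of "Poly_Mapping.lookup m i" i] by simp
  then have "coord_poly (\<Sum>i\<in>UNIV. Poly_Mapping.lookup m i) (\<lambda>y. \<Prod>i\<in>UNIV. (w y $ i) ^ Poly_Mapping.lookup m i)"
    by (intro coord_poly_prod) auto
  then have "coord_poly (0 + (\<Sum>i\<in>UNIV. Poly_Mapping.lookup m i))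
     (\<lambda>y. Poly_Mapping.lookup p m * (\<Prod>i\<in>UNIV. (w y $ i) ^ Poly_Mapping.lookup m i))"
    by (rule coord_poly_mult[OF coord_poly_const])
  then show "coord_poly (rpoly_degree p)
     (\<lambda>y. Poly_Mapping.lookup p m * (\<Prod>i\<in>UNIV. (w y $ i) ^ Poly_Mapping.lookup m i))"
    by (rule coord_poly_mono) (use lookup_sum_le_degree[OF m] in simp)
qed

section \<open>Elementary symmetric polynomials\<close>

definition esym :: "'n::finite set \<Rightarrow> real^'n \<Rightarrow> nat \<Rightarrow> real" where
  "esym A c k = (\<Sum>S | S \<subseteq> A \<and> card S = k. \<Prod>i\<in>S. c $ i)"

lemma esym_0: "esym A c 0 = 1"
proof -
  have "{S. S \<subseteq> A \<and> card S = 0} = {{}}" by (auto simp: card_eq_0_iff)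
  then show ?thesis by (simp add: esym_def)
qed

lemma esym_zero: "card A < k \<Longrightarrow> esym A c k = 0"
proof -
  assume "card A < k"
  then have "{S. S \<subseteq> A \<and> card S = k} = {}" by (auto simp: not_less[symmetric] dest: card_mono[OF finite])
  then show ?thesis by (simp only: esym_def sum.empty)
qed

lemma esym_insert:
  fixes A :: "'n::finite set"
  assumes "i \<notin> A"
  shows "esym (insert i A) c (Suc k) = esym A c (Suc k) + c $ i * esym A c k"
proof -
  let ?L = "{S. S \<subseteq> insert i A \<and> card S = Suc k}"
  have eq: "?L = {S. S \<subseteq> A \<and> card S = Suc k} \<union> insert i ` {S. S \<subseteq> A \<and> card S = k}" (is "_ = ?P \<union> ?Q")
  proof (intro equalityI subsetI)
    fix S assume S: "S \<in> ?L"
    show "S \<in> ?P \<union> ?Q"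
    proof (cases "i \<in> S")
      case True
      then have "S = insert i (S - {i})" "S - {i} \<subseteq> A" "card (S - {i}) = k" using S by auto
      then show ?thesis by blast
    qed (use S in auto)
  next
    fix S assume S: "S \<in> ?P \<union> ?Q"
    then show "S \<in> ?L"
    proof
      assume "S \<in> ?Q"
      then obtain T where "S = insert i T" "T \<subseteq> A" "card T = k" by auto
      moreover then have "i \<notin> T" using assms by auto
      ultimately show ?thesis by auto
    qed auto
  qed
  have inj: "inj_on (insert i) {S. S \<subseteq> A \<and> card S = k}"
    using assms by (intro inj_onI) (metis insert_ident mem_Collect_eq subsetD)
  have "(\<Sum>S\<in>?L. \<Prod>i\<in>S. c $ i) = (\<Sum>S\<in>?P. \<Prod>i\<in>S. c $ i) + (\<Sum>S\<in>?Q. \<Prod>i\<in>S. c $ i)"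
    unfolding eq using assms by (intro sum.union_disjoint) auto
  also have "(\<Sum>S\<in>?Q. \<Prod>i\<in>S. c $ i) = (\<Sum>S | S \<subseteq> A \<and> card S = k. c $ i * (\<Prod>i\<in>S. c $ i))"
    using assms by (subst sum.reindex[OF inj]) (auto intro!: sum.cong prod.insert)
  finally show ?thesis
    by (simp add: esym_def sum_distrib_left)
qed

lemma prod_add_esym:
  fixes A :: "'n::finite set"
  shows "(\<Prod>i\<in>A. t + c $ i) = (\<Sum>k\<le>card A. esym A c k * t ^ (card A - k))"
proof -
  have "(\<Prod>i\<in>A. t + c $ i) = (\<Prod>i\<in>A. c $ i + t)" by (simp add: add.commute)
  also have "\<dots> = (\<Sum>S\<in>Pow A. (\<Prod>i\<in>S. c $ i) * (\<Prod>i\<in>A-S. t))"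
    by (rule prod_add) simp
  also have "\<dots> = (\<Sum>S\<in>Pow A. (\<Prod>i\<in>S. c $ i) * t ^ (card A - card S))"
    by (intro sum.cong refl) (auto simp: card_Diff_subset)
  also have "\<dots> = (\<Sum>k\<le>card A. \<Sum>S\<in>{S \<in> Pow A. card S = k}. (\<Prod>i\<in>S. c $ i) * t ^ (card A - card S))"
    by (rule sum.group[symmetric]) (auto intro: card_mono)
  also have "\<dots> = (\<Sum>k\<le>card A. esym A c k * t ^ (card A - k))"
    by (simp add: esym_def sum_distrib_right)
  finally show ?thesis .
qed

text \<open>
  The recursion \<open>e_(k+1)(all) = e_(k+1)(without i) + c_i e_k(without i)\<close> solved for the elementary
  symmetric polynomials of the remaining variables. Thus these are polynomials in \<open>c_i\<close> whose
  coefficients are symmetric in all variables.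
\<close>

lemma esym_Diff:
  fixes i :: "'n::finite"
  shows "esym (UNIV - {i}) c k = (\<Sum>l\<le>k. (- (c $ i)) ^ l * esym UNIV c (k - l))"
proof (induction k)
  case (Suc k)
  have "esym UNIV c (Suc k) = esym (UNIV - {i}) c (Suc k) + c $ i * esym (UNIV - {i}) c k"
    using esym_insert[of i "UNIV - {i}" c k] by (simp add: insert_UNIV)
  then have "esym (UNIV - {i}) c (Suc k) = esym UNIV c (Suc k) + (- (c $ i)) * (\<Sum>l\<le>k. (- (c $ i)) ^ l * esym UNIV c (k - l))"
    using Suc by simp
  also have "\<dots> = (\<Sum>l\<le>Suc k. (- (c $ i)) ^ l * esym UNIV c (Suc k - l))"
    by (simp only: sum.atMost_Suc_shift sum_distrib_left) (simp add: mult.assoc)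
  finally show ?case .
qed (simp add: esym_0)

lemma sum_esym_Diff:
  fixes c :: "real^'n::finite"
  shows "(\<Sum>i\<in>UNIV. esym (UNIV - {i}) c k) = real (CARD('n) - k) * esym UNIV c k"
proof -
  have "(\<Sum>i\<in>UNIV. esym (UNIV - {i}) c k)
      = (\<Sum>i\<in>UNIV. \<Sum>S | S \<in> {S. card S = k} \<and> i \<notin> S. \<Prod>i\<in>S. c $ i)"
    unfolding esym_def by (intro sum.cong refl) (auto simp: subset_iff)
  also have "\<dots> = (\<Sum>S | card S = k. \<Sum>i | i \<notin> S. \<Prod>i\<in>S. c $ i)"
    using sum.swap_restrict[of UNIV "{S. card S = k}" "\<lambda>i S. \<Prod>i\<in>S. c $ i" "\<lambda>i S. i \<notin> S"] by simp
  also have "\<dots> = (\<Sum>S | card S = k. real (CARD('n) - k) * (\<Prod>i\<in>S. c $ i))"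
  proof (intro sum.cong refl)
    fix S :: "'n set" assume "S \<in> {S. card S = k}"
    moreover have "{i. i \<notin> S} = - S" by auto
    ultimately show "(\<Sum>i | i \<notin> S. \<Prod>i\<in>S. c $ i) = real (CARD('n) - k) * (\<Prod>i\<in>S. c $ i)"
      by (simp add: Compl_eq_Diff_UNIV card_Diff_subset)
  qed
  finally show ?thesis by (simp add: esym_def sum_distrib_left)
qed

text \<open>
  Summing the expansion of \<open>e_k(without i)\<close> over all \<open>i\<close> expresses the \<open>k\<close>-th power sum, taken with alternating signs,
  through lower ones and the elementary symmetric polynomials. It also covers \<open>k\<close> above the
  number of variables: there the truncated difference is harmless, as the elementary symmetric
  polynomial vanishes too.
\<close>

lemma newton_identity:
  fixes c :: "real^'n::finite"
  shows "(\<Sum>i\<in>UNIV. (- (c $ i)) ^ k) =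
    real (CARD('n) - k) * esym UNIV c k - (\<Sum>l<k. (\<Sum>i\<in>UNIV. (- (c $ i)) ^ l) * esym UNIV c (k - l))"
proof -
  have "real (CARD('n) - k) * esym UNIV c k = (\<Sum>i\<in>UNIV. \<Sum>l\<le>k. (- (c $ i)) ^ l * esym UNIV c (k - l))"
    by (simp only: sum_esym_Diff[symmetric] esym_Diff)
  also have "\<dots> = (\<Sum>l\<le>k. (\<Sum>i\<in>UNIV. (- (c $ i)) ^ l) * esym UNIV c (k - l))"
    by (subst sum.swap) (simp add: sum_distrib_right)
  finally show ?thesis by (simp add: lessThan_Suc_atMost[symmetric] esym_0)
qed

section \<open>The map phi in terms of the cosines of the coordinates\<close>

definition cos_vec :: "real^'n \<Rightarrow> real^'n" where
  "cos_vec x = (\<chi> i. cos (pi * x $ i))"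

definition permute_vec :: "('n \<Rightarrow> 'n) \<Rightarrow> 'a^'n \<Rightarrow> 'a^'n" where
  "permute_vec \<sigma> x = (\<chi> i. x $ \<sigma> i)"

text \<open>
  The order of the stabilizer of \<open>{..j}\<close>, that is \<open>k! (n - k)!\<close> with \<open>k = card {..j}\<close>: the
  factor by which \<open>X_var j\<close> differs from the elementary symmetric polynomial of degree \<open>k\<close>.
\<close>

definition X_factor :: "'n::{finite,wellorder} \<Rightarrow> nat" where
  "X_factor j = card {\<sigma>. \<sigma> permutes UNIV \<and> \<sigma> -` {..j} = {..j}}"

lemma ex_permutes_vimage:
  fixes S T :: "'n::finite set"
  assumes "card S = card T"
  obtains \<tau> where "\<tau> permutes UNIV" "\<tau> -` T = S"
proof -
  obtain f where f: "bij_betw f S T"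
    using assms finite_same_card_bij[of S T] by auto
  have "card (- S) = card (- T)"
    using assms by (simp add: Compl_eq_Diff_UNIV card_Diff_subset)
  then obtain g where g: "bij_betw g (- S) (- T)"
    using finite_same_card_bij[of "- S" "- T"] by auto
  define \<tau> where "\<tau> = (\<lambda>i. if i \<in> S then f i else g i)"
  have "bij_betw \<tau> (S \<union> - S) (T \<union> - T)"
    unfolding \<tau>_def using f g by (intro bij_betw_disjoint_Un) auto
  then have 1: "\<tau> permutes UNIV"
    by (intro bij_imp_permutes) auto
  have "\<tau> i \<in> T \<longleftrightarrow> i \<in> S" for i
    using f g by (auto simp: \<tau>_def bij_betw_def)
  then have 2: "\<tau> -` T = S" by auto
  from 1 2 show ?thesis by (rule that)
qed

text \<open>
  The permutations carrying \<open>S\<close> onto \<open>T\<close> form a coset of the stabilizer of \<open>T\<close>.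
\<close>

lemma card_permutes_vimage:
  fixes S T :: "'n::finite set"
  assumes "card S = card T"
  shows "card {\<sigma>. \<sigma> permutes UNIV \<and> \<sigma> -` T = S} = card {\<sigma>. \<sigma> permutes UNIV \<and> \<sigma> -` T = T}"
proof -
  obtain \<tau> where \<tau>: "\<tau> permutes UNIV" "\<tau> -` T = S" using assms ex_permutes_vimage by blast
  note inv = permutes_inv[OF \<tau>(1)] permutes_inv_o[OF \<tau>(1)]
  have "bij_betw (\<lambda>\<sigma>. \<sigma> \<circ> \<tau>) {\<sigma>. \<sigma> permutes UNIV \<and> \<sigma> -` T = T} {\<sigma>. \<sigma> permutes UNIV \<and> \<sigma> -` T = S}"
  proof (rule bij_betw_byWitness[where f' = "\<lambda>\<sigma>. \<sigma> \<circ> Hilbert_Choice.inv \<tau>"])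
    have "Hilbert_Choice.inv \<tau> -` S = T"
      using \<tau> inv by (auto simp: vimage_def permutes_inverses)
    then show "(\<lambda>\<sigma>. \<sigma> \<circ> Hilbert_Choice.inv \<tau>) ` {\<sigma>. \<sigma> permutes UNIV \<and> \<sigma> -` T = S} \<subseteq> {\<sigma>. \<sigma> permutes UNIV \<and> \<sigma> -` T = T}"
      using inv(1) by (auto simp: vimage_comp[symmetric] intro: permutes_compose)
  qed (use \<tau> inv in \<open>auto simp: comp_assoc vimage_comp[symmetric] intro: permutes_compose\<close>)
  then show ?thesis by (simp add: bij_betw_same_card)
qed

lemma X_factor_pos: "X_factor j > 0"
proof -
  have "id \<in> {\<sigma>. \<sigma> permutes UNIV \<and> \<sigma> -` {..j} = {..j}}" by (simp add: permutes_id)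
  then show ?thesis unfolding X_factor_def
    by (subst card_gt_0_iff) (metis (no_types, lifting) empty_iff finite_code finite_permutations rev_finite_subset mem_Collect_eq subsetI finite_UNIV)
qed

text \<open>
  A permutation contributes the product of the cosines over the preimage of \<open>{..j}\<close>, and every set
  of the right size is such a preimage equally often.
\<close>

lemma X_var_esym:
  fixes x :: "real^'n::{finite,wellorder}"
  shows "X_var j x = real (X_factor j) * esym UNIV (cos_vec x) (card {..j})"
proof -
  let ?c = "\<lambda>i. cos (pi * x $ i)"
  let ?P = "{\<sigma>::'n \<Rightarrow> 'n. \<sigma> permutes UNIV}"
  have "X_var j x = (\<Sum>\<sigma>\<in>?P. \<Prod>i\<in>UNIV. if \<sigma> i \<le> j then ?c i else 1)"
    unfolding X_var_def cos_plus_def by (intro sum.cong prod.cong refl) auto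
  also have "\<dots> = (\<Sum>\<sigma>\<in>?P. prod ?c (\<sigma> -` {..j}))"
    by (intro sum.cong refl) (simp add: prod.If_cases vimage_def)
  also have "\<dots> = (\<Sum>S | card S = card {..j}. \<Sum>\<sigma>\<in>{\<sigma> \<in> ?P. \<sigma> -` {..j} = S}. prod ?c (\<sigma> -` {..j}))"
  proof (rule sum.group[symmetric])
    show "(\<lambda>\<sigma>. \<sigma> -` {..j}) ` ?P \<subseteq> {S. card S = card {..j}}"
      by (auto intro!: card_vimage_inj dest: permutes_inj simp: permutes_surj)
  qed (simp_all add: finite_permutations)
  also have "\<dots> = (\<Sum>S | card S = card {..j}. real (X_factor j) * prod ?c S)"
  proof (intro sum.cong refl)
    fix S :: "'n set" assume "S \<in> {S. card S = card {..j}}"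
    then show "(\<Sum>\<sigma>\<in>{\<sigma> \<in> ?P. \<sigma> -` {..j} = S}. prod ?c (\<sigma> -` {..j})) = real (X_factor j) * prod ?c S"
      using card_permutes_vimage[of S "{..j}"] by (simp add: X_factor_def)
  qed
  finally show ?thesis
    by (simp add: esym_def sum_distrib_left cos_vec_def)
qed

lemma bij_betw_rank: "bij_betw (\<lambda>j::'n::{finite,wellorder}. card {..j}) UNIV {1..CARD('n)}"
proof -
  have "strict_mono (\<lambda>j::'n. card {..j})"
    by (intro strict_monoI psubset_card_mono) auto
  then have inj: "inj (\<lambda>j::'n. card {..j})" by (rule strict_mono_imp_inj_on)
  have "range (\<lambda>j::'n. card {..j}) \<subseteq> {1..CARD('n)}"
    by (auto simp: Suc_le_eq card_gt_0_iff intro!: card_mono)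
  moreover have "card (range (\<lambda>j::'n. card {..j})) = card {1..CARD('n)}"
    using inj by (simp add: card_image)
  ultimately show ?thesis
    using inj by (simp add: bij_betw_def card_subset_eq)
qed

lemma ex_rank: "1 \<le> k \<Longrightarrow> k \<le> CARD('n) \<Longrightarrow> \<exists>j::'n::{finite,wellorder}. card {..j} = k"
  using bij_betw_rank[where 'n='n] unfolding bij_betw_def by (metis atLeastAtMost_iff imageE)

section \<open>The squared Jacobian and the squared density as polynomials in phi\<close>

definition phi_poly :: "(real^'n::{finite,wellorder} \<Rightarrow> real) \<Rightarrow> bool" where
  "phi_poly h \<longleftrightarrow> (\<exists>d g. coord_poly d g \<and> (\<forall>x. h x = g (phi x)))"

lemma phi_poly_const: "phi_poly (\<lambda>x. a)"
  unfolding phi_poly_def using coord_poly_const by blast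

lemma phi_poly_add:
  assumes "phi_poly g" "phi_poly h" shows "phi_poly (\<lambda>x. g x + h x)"
proof -
  obtain d d' g' h' where "coord_poly d g'" "\<forall>x. g x = g' (phi x)" "coord_poly d' h'" "\<forall>x. h x = h' (phi x)"
    using assms unfolding phi_poly_def by blast
  moreover from this have "coord_poly (max d d') (\<lambda>y. g' y + h' y)"
    by (intro coord_poly_add) (auto elim: coord_poly_mono)
  ultimately show ?thesis unfolding phi_poly_def by auto
qed

lemma phi_poly_mult:
  assumes "phi_poly g" "phi_poly h" shows "phi_poly (\<lambda>x. g x * h x)"
proof -
  obtain d d' g' h' where "coord_poly d g'" "\<forall>x. g x = g' (phi x)" "coord_poly d' h'" "\<forall>x. h x = h' (phi x)"
    using assms unfolding phi_poly_def by blast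
  moreover from this have "coord_poly (d + d') (\<lambda>y. g' y * h' y)"
    by (intro coord_poly_mult)
  ultimately show ?thesis unfolding phi_poly_def by auto
qed

lemma phi_poly_sum: "(\<And>i. i \<in> A \<Longrightarrow> phi_poly (h i)) \<Longrightarrow> phi_poly (\<lambda>x. \<Sum>i\<in>A. h i x)"
  by (induction A rule: infinite_finite_induct) (auto intro: phi_poly_const phi_poly_add)

lemma phi_poly_prod: "(\<And>i. i \<in> A \<Longrightarrow> phi_poly (h i)) \<Longrightarrow> phi_poly (\<lambda>x. \<Prod>i\<in>A. h i x)"
  by (induction A rule: infinite_finite_induct) (auto intro: phi_poly_const phi_poly_mult)

lemma phi_poly_diff: "phi_poly g \<Longrightarrow> phi_poly h \<Longrightarrow> phi_poly (\<lambda>x. g x - h x)"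
  using phi_poly_add[of g "\<lambda>x. (-1) * h x"] phi_poly_mult[OF phi_poly_const[of "-1"], of h] by simp

lemma phi_poly_imp_rpoly: "phi_poly h \<Longrightarrow> \<exists>p. \<forall>x. rpoly_eval p (phi x) = h x"
  unfolding phi_poly_def using coord_poly_imp_rpoly by metis

lemma phi_poly_esym: "phi_poly (\<lambda>x::real^'n::{finite,wellorder}. esym UNIV (cos_vec x) k)"
proof -
  consider "k = 0" | "k > CARD('n)" | "1 \<le> k" "k \<le> CARD('n)" by linarith
  then show ?thesis
  proof cases
    case 3
    then obtain j :: 'n where j: "card {..j} = k" using ex_rank by blast
    have "phi_poly (\<lambda>x. phi x $ j)"
      unfolding phi_poly_def using coord_poly_coord[of j] by blast
    then have "phi_poly (\<lambda>x. 1 / real (X_factor j) * phi x $ j)"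
      by (intro phi_poly_mult phi_poly_const)
    then show ?thesis
      using X_factor_pos[of j] by (simp add: phi_def X_var_esym j)
  qed (simp_all add: esym_0 esym_zero phi_poly_const)
qed

lemma phi_poly_power_sum: "phi_poly (\<lambda>x::real^'n::{finite,wellorder}. \<Sum>i\<in>UNIV. (- (cos_vec x $ i)) ^ k)"
proof (induction k rule: less_induct)
  case (less k)
  then show ?case
    by (subst newton_identity)
       (intro phi_poly_diff phi_poly_mult phi_poly_const phi_poly_esym phi_poly_sum[of "{..<k}"]; simp)
qed

lemma esym_Diff_poly:
  fixes i :: "'n::finite"
  shows "esym (UNIV - {i}) c k = (\<Sum>l\<le>k. esym UNIV c (k - l) * (- (c $ i)) ^ l)"
  by (simp add: esym_Diff mult.commute)

lemma cos_rho_square: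
  fixes x :: "real^'n::{finite,wellorder}"
  shows "(cos_plus (\<chi> i. 1 / 2) x)\<^sup>2 = (fact CARD('n))\<^sup>2 * (\<Prod>i\<in>UNIV. (1 + cos_vec x $ i) / 2)"
proof -
  have "(cos (pi * (1 / 2) * t))\<^sup>2 = (1 + cos (pi * t)) / 2" for t :: real
    using cos_double_cos[of "pi * (1 / 2) * t"] by simp
  note half = this
  have "cos_plus (\<chi> i. 1 / 2) x = fact CARD('n) * (\<Prod>i\<in>UNIV. cos (pi * (1 / 2) * x $ i))"
    by (simp add: cos_plus_def card_permutations)
  then show ?thesis
    by (simp only: power_mult_distrib prod_power_distrib half cos_vec_def vec_lambda_beta)
qed

lemma phi_poly_cos_rho_square:
  "phi_poly (\<lambda>x::real^'n::{finite,wellorder}. (cos_plus (\<chi> i. 1 / 2) x)\<^sup>2)"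
proof -
  have "(\<Prod>i\<in>UNIV. (1 + c $ i) / 2) = (1 / 2) ^ CARD('n) * (\<Sum>k\<le>CARD('n). esym UNIV c k)" for c :: "real^'n::_"
    using prod_add_esym[of 1 c UNIV] by (simp add: prod_dividef power_one_over field_simps)
  then show ?thesis
    unfolding cos_rho_square
    by (auto intro!: phi_poly_mult phi_poly_const phi_poly_sum phi_poly_esym)
qed

lemma J_III_phi:
  fixes x :: "real^'n::{finite,wellorder}"
  assumes "x \<in> fund_dom"
  shows "rpoly_eval J_III (phi x) = (cos_plus (\<chi> i. 1 / 2) x)\<^sup>2"
  using someI_ex[of "\<lambda>p. \<forall>x\<in>fund_dom. rpoly_eval p (phi x) = (cos_plus (\<chi> i. 1 / 2) (x::real^'n::_))\<^sup>2"]
    phi_poly_imp_rpoly[OF phi_poly_cos_rho_square] assms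
  unfolding J_III_def by blast

definition jac_mat :: "real^'n::{finite,wellorder} \<Rightarrow> real^'n::_^'n::_" where
  "jac_mat x = (\<chi> j i. real (X_factor j) * esym (UNIV - {i}) (cos_vec x) (card {..j} - 1)
                  * (- pi * sin (pi * x $ i)))"

lemma sum_subsets_remove:
  fixes F :: "'n::finite \<Rightarrow> real"
  assumes "k > 0"
  shows "(\<Sum>S | card S = k. \<Sum>i\<in>S. F i * (\<Prod>j\<in>S-{i}. c $ j))
       = (\<Sum>i\<in>UNIV. F i * esym (UNIV - {i}) c (k - 1))"
proof -
  have "(\<Sum>S | card S = k. \<Sum>i\<in>S. F i * (\<Prod>j\<in>S-{i}. c $ j))
      = (\<Sum>S\<in>{S. card S = k}. \<Sum>i | i \<in> UNIV \<and> i \<in> S. F i * (\<Prod>j\<in>S-{i}. c $ j))"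
    by simp
  also have "\<dots> = (\<Sum>i\<in>UNIV. \<Sum>S | S \<in> {S. card S = k} \<and> i \<in> S. F i * (\<Prod>j\<in>S-{i}. c $ j))"
    by (rule sum.swap_restrict) auto
  also have "\<dots> = (\<Sum>i\<in>UNIV. F i * esym (UNIV - {i}) c (k - 1))"
  proof (intro sum.cong refl)
    fix i :: 'n
    have "(\<Sum>S | S \<in> {S. card S = k} \<and> i \<in> S. \<Prod>j\<in>S-{i}. c $ j)
        = (\<Sum>S | S \<subseteq> UNIV - {i} \<and> card S = k - 1. \<Prod>j\<in>S. c $ j)"
      using assms
      by (intro sum.reindex_bij_witness[of _ "insert i" "\<lambda>S. S - {i}"]) (auto simp: insert_absorb subset_iff card_insert_if)
    then show "(\<Sum>S | S \<in> {S. card S = k} \<and> i \<in> S. F i * (\<Prod>j\<in>S-{i}. c $ j)) = F i * esym (UNIV - {i}) c (k - 1)"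
      by (simp add: esym_def sum_distrib_left[symmetric])
  qed
  finally show ?thesis .
qed

lemma X_var_has_derivative:
  fixes x :: "real^'n::{finite,wellorder}"
  shows "(X_var j has_derivative (\<lambda>v. \<Sum>i\<in>UNIV. jac_mat x $ j $ i * v $ i)) (at x)"
proof -
  have k: "card {..j} > 0" by (simp add: card_gt_0_iff)
  have c: "((\<lambda>x. cos (pi * x $ i)) has_derivative (\<lambda>v. - sin (pi * x $ i) * (pi * v $ i))) (at x)" for i
  proof -
    have "((\<lambda>x. x $ i) has_derivative (\<lambda>v. v $ i)) (at x)"
      by (rule bounded_linear_imp_has_derivative[OF bounded_linear_vec_nth])
    then have "((\<lambda>x. pi * x $ i) has_derivative (\<lambda>v. pi * v $ i)) (at x)"
      by (rule has_derivative_mult_right)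
    from has_derivative_cos[OF this] show ?thesis by (simp add: mult.commute)
  qed
  have d: "((\<lambda>x. \<Prod>i\<in>S. cos (pi * x $ i)) has_derivative (\<lambda>v. \<Sum>i\<in>S.
        (- sin (pi * x $ i) * (pi * v $ i)) * (\<Prod>l\<in>S-{i}. cos_vec x $ l))) (at x)" for S
    unfolding cos_vec_def vec_lambda_beta by (rule has_derivative_prod[OF c])
  have "X_var j = (\<lambda>x. real (X_factor j) * (\<Sum>S | card S = card {..j}. \<Prod>i\<in>S. cos (pi * x $ i)))"
    by (rule ext) (simp add: X_var_esym esym_def cos_vec_def)
  moreover have "((\<lambda>x. real (X_factor j) * (\<Sum>S | card S = card {..j}. \<Prod>i\<in>S. cos (pi * x $ i)))
      has_derivative (\<lambda>v. real (X_factor j) * (\<Sum>S | card S = card {..j}. \<Sum>i\<in>S.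
        (- sin (pi * x $ i) * (pi * v $ i)) * (\<Prod>l\<in>S-{i}. cos_vec x $ l)))) (at x)"
    by (intro has_derivative_mult_right has_derivative_sum d)
  moreover have "real (X_factor j) * (\<Sum>S | card S = card {..j}. \<Sum>i\<in>S.
        (- sin (pi * x $ i) * (pi * v $ i)) * (\<Prod>l\<in>S-{i}. cos_vec x $ l)) = (\<Sum>i\<in>UNIV. jac_mat x $ j $ i * v $ i)" for v
    by (simp only: sum_subsets_remove[OF k]) (simp add: jac_mat_def sum_distrib_left mult_ac)
  ultimately show ?thesis by simp
qed

lemma phi_has_derivative:
  fixes x :: "real^'n::{finite,wellorder}"
  shows "(phi has_derivative (*v) (jac_mat x)) (at x)"
proof (subst has_derivative_componentwise_within, intro ballI)
  fix b :: "real^'n::_" assume "b \<in> Basis"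
  then obtain j where b: "b = axis j 1" by (auto simp: Basis_vec_def)
  have "(\<lambda>x. phi x \<bullet> b) = X_var j" 
    by (rule ext) (simp add: b inner_axis phi_def)
  moreover have "(\<lambda>v. (jac_mat x *v v) \<bullet> b) = (\<lambda>v. \<Sum>i\<in>UNIV. jac_mat x $ j $ i * v $ i)"
    by (simp add: b inner_axis matrix_vector_mult_def)
  ultimately show "((\<lambda>x. phi x \<bullet> b) has_derivative (\<lambda>v. (jac_mat x *v v) \<bullet> b)) (at x)"
    using X_var_has_derivative by simp
qed

lemma jac_det_eq: "jac_det x = det (jac_mat x)"
  unfolding jac_det_def jacobian_def frechet_derivative_at[OF phi_has_derivative, symmetric] by simp

lemma phi_poly_det:
  assumes "\<And>i j. phi_poly (\<lambda>x. M x $ i $ j)"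
  shows "phi_poly (\<lambda>x. det (M x))"
  unfolding det_def using assms by (intro phi_poly_sum phi_poly_mult phi_poly_const phi_poly_prod)

text \<open>
  For the Jacobian matrix \<open>M\<close>, the square of its determinant is \<open>det (M M\<^sup>T)\<close>. An entry of \<open>M M\<^sup>T\<close> is a sum over
  all \<open>i\<close> of one and the same polynomial in \<open>c_i\<close> with symmetric coefficients, because the two sine factors
  combine to \<open>1 - c_i\<^sup>2\<close>. Such a sum is a combination of power sums, so the entry is a polynomial
  in \<open>phi\<close>.
\<close>

lemma phi_poly_jac_det_square: "phi_poly (\<lambda>x::real^'n::{finite,wellorder}. (jac_det x)\<^sup>2)"
proof -
  have "(jac_det x)\<^sup>2 = det (jac_mat x ** transpose (jac_mat x))" for x :: "real^'n::_"
    by (simp add: jac_det_eq det_mul power2_eq_square)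
  moreover have "phi_poly (\<lambda>x::real^'n::_. (jac_mat x ** transpose (jac_mat x)) $ j $ k)" for j k
  proof -
    let ?e = "\<lambda>x::real^'n::_. esym UNIV (cos_vec x)" and ?r = "\<lambda>j. card {..j} - 1"
    let ?f = "real (X_factor j) * real (X_factor k) * pi\<^sup>2"
    have s: "(sin t)\<^sup>2 = 1 - (cos t)\<^sup>2" for t :: real by (simp add: sin_squared_eq)
    have eq: "(jac_mat x ** transpose (jac_mat x)) $ j $ k = (\<Sum>l\<le>?r j. \<Sum>m\<le>?r k.
          (?f * ?e x (?r j - l) * ?e x (?r k - m)) * (\<Sum>i\<in>UNIV. (- (cos_vec x $ i)) ^ (l + m))
        + (- ?f * ?e x (?r j - l) * ?e x (?r k - m)) * (\<Sum>i\<in>UNIV. (- (cos_vec x $ i)) ^ (l + m + 2)))"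
      for x :: "real^'n::_"
    proof -
      have "(jac_mat x ** transpose (jac_mat x)) $ j $ k
         = (\<Sum>i\<in>UNIV. ?f * esym (UNIV - {i}) (cos_vec x) (?r j) * esym (UNIV - {i}) (cos_vec x) (?r k)
               * (1 - (- (cos_vec x $ i))\<^sup>2))"
        unfolding matrix_matrix_mult_def transpose_def jac_mat_def
        by (simp add: cos_vec_def s[symmetric]) (simp add: power2_eq_square mult_ac)
      also have "\<dots> = (\<Sum>i\<in>UNIV. \<Sum>l\<le>?r j. \<Sum>m\<le>?r k.
            (?f * ?e x (?r j - l) * ?e x (?r k - m)) * (- (cos_vec x $ i)) ^ (l + m)
          + (- ?f * ?e x (?r j - l) * ?e x (?r k - m)) * (- (cos_vec x $ i)) ^ (l + m + 2))"
      proof (rule sum.cong[OF refl])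
        fix i
        let ?z = "- (cos_vec x $ i)"
        have "?f * (\<Sum>l\<le>?r j. ?e x (?r j - l) * ?z ^ l) * (\<Sum>m\<le>?r k. ?e x (?r k - m) * ?z ^ m) * (1 - ?z\<^sup>2)
           = (\<Sum>l\<le>?r j. \<Sum>m\<le>?r k. ?f * ((?e x (?r j - l) * ?z ^ l) * (?e x (?r k - m) * ?z ^ m)) * (1 - ?z\<^sup>2))"
          by (simp only: mult.assoc[of ?f] sum_product sum_distrib_left sum_distrib_right, rule sum.swap)
        also have "\<dots> = (\<Sum>l\<le>?r j. \<Sum>m\<le>?r k.
            (?f * ?e x (?r j - l) * ?e x (?r k - m)) * ?z ^ (l + m)
          + (- ?f * ?e x (?r j - l) * ?e x (?r k - m)) * ?z ^ (l + m + 2))"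
          by (intro sum.cong refl) (simp only: power_add, algebra)
        finally show "?f * esym (UNIV - {i}) (cos_vec x) (?r j) * esym (UNIV - {i}) (cos_vec x) (?r k) * (1 - ?z\<^sup>2)
           = (\<Sum>l\<le>?r j. \<Sum>m\<le>?r k.
            (?f * ?e x (?r j - l) * ?e x (?r k - m)) * ?z ^ (l + m)
          + (- ?f * ?e x (?r j - l) * ?e x (?r k - m)) * ?z ^ (l + m + 2))"
          unfolding esym_Diff_poly .
      qed
      also have "\<dots> = (\<Sum>l\<le>?r j. \<Sum>m\<le>?r k.
            (?f * ?e x (?r j - l) * ?e x (?r k - m)) * (\<Sum>i\<in>UNIV. (- (cos_vec x $ i)) ^ (l + m))
          + (- ?f * ?e x (?r j - l) * ?e x (?r k - m)) * (\<Sum>i\<in>UNIV. (- (cos_vec x $ i)) ^ (l + m + 2)))"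
        by (subst sum.swap, intro sum.cong refl, subst sum.swap)
           (simp only: sum.distrib sum_distrib_left)
      finally show ?thesis .
    qed
    show ?thesis unfolding eq
      by (intro phi_poly_sum phi_poly_add phi_poly_mult phi_poly_const phi_poly_esym phi_poly_power_sum)
  qed
  ultimately show ?thesis by (simp only:) (rule phi_poly_det)
qed

lemma cal_J_phi:
  fixes x :: "real^'n::{finite,wellorder}"
  assumes "x \<in> fund_dom"
  shows "cal_J (phi x) = \<bar>jac_det x\<bar>"
proof -
  have "rpoly_eval p_I (phi x) = (jac_det x)\<^sup>2"
    using someI_ex[of "\<lambda>p. \<forall>x\<in>fund_dom. rpoly_eval p (phi x) = (jac_det (x::real^'n::_))\<^sup>2"]
      phi_poly_imp_rpoly[OF phi_poly_jac_det_square] assms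
    unfolding p_I_def by blast
  then show ?thesis by (simp add: cal_J_def)
qed

text \<open>
  A vector in the kernel of the Jacobian matrix yields, after absorbing the sines, numbers \<open>u_i\<close> with
  \<open>\<Sum>i. u_i (\<Prod>l \<noteq> i. t + c_l) = 0\<close> for all \<open>t\<close>. At \<open>t = - c_m\<close> only the term of \<open>m\<close> survives,
  and its product does not vanish as the cosines are distinct.
\<close>

lemma jac_det_nonzero:
  fixes x :: "real^'n::{finite,wellorder}"
  assumes "\<And>i. 0 < x $ i" "\<And>i. x $ i < 1" and inj: "inj (($) x)"
  shows "jac_det x \<noteq> 0"
proof -
  define c where "c = cos_vec x"
  have cinj: "c $ i \<noteq> c $ j" if "i \<noteq> j" for i j
  proof
    assume "c $ i = c $ j"
    then have "cos (pi * x $ i) = cos (pi * x $ j)" by (simp add: c_def cos_vec_def)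
    then have "pi * x $ i = pi * x $ j"
      by (rule cos_inj_pi[rotated -1]) (use assms(1,2)[THEN less_imp_le] in auto)
    then show False using injD[OF inj, of i j] that by simp
  qed
  have sin_pos: "sin (pi * x $ i) > 0" for i
    using assms by (intro sin_gt_zero) auto
  have "w = 0" if w: "jac_mat x *v w = 0" for w
  proof -
    define u where "u i = sin (pi * x $ i) * w $ i" for i
    have u0: "(\<Sum>i\<in>UNIV. esym (UNIV - {i}) c k * u i) = 0" if k: "k < CARD('n)" for k
    proof -
      obtain j :: 'n where j: "card {..j} = Suc k" using ex_rank[where 'n='n, of "Suc k"] k by auto
      have "0 = (jac_mat x *v w) $ j" by (simp add: w)
      also have "\<dots> = (- (pi * X_factor j)) * (\<Sum>i\<in>UNIV. esym (UNIV - {i}) c k * u i)"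
        by (simp add: matrix_vector_mult_def jac_mat_def j u_def c_def sum_distrib_left mult_ac sum_negf)
      finally show ?thesis using X_factor_pos[of j] by simp
    qed
    have eval0: "(\<Sum>i\<in>UNIV. (\<Prod>l\<in>UNIV-{i}. t + c $ l) * u i) = 0" for t
    proof -
      have "(\<Sum>i\<in>UNIV. (\<Prod>l\<in>UNIV-{i}. t + c $ l) * u i)
          = (\<Sum>i\<in>UNIV. \<Sum>k\<le>CARD('n) - 1. t ^ (CARD('n) - 1 - k) * (esym (UNIV-{i}) c k * u i))"
        by (simp add: prod_add_esym sum_distrib_right sum_distrib_left mult_ac card_Diff_subset)
      also have "\<dots> = (\<Sum>k\<le>CARD('n) - 1. t ^ (CARD('n) - 1 - k) * (\<Sum>i\<in>UNIV. esym (UNIV-{i}) c k * u i))"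
        by (subst sum.swap) (simp add: sum_distrib_left)
      also have "\<dots> = 0"
      proof (rule sum.neutral, rule ballI)
        fix k assume "k \<in> {..CARD('n) - 1}"
        then have "k < CARD('n)" using zero_less_card_finite[where 'a='n] unfolding atMost_iff by arith
        then show "t ^ (CARD('n) - 1 - k) * (\<Sum>i\<in>UNIV. esym (UNIV-{i}) c k * u i) = 0" by (simp add: u0)
      qed
      finally show ?thesis .
    qed
    have "w $ m = 0" for m
    proof -
      have "(\<Prod>l\<in>UNIV-{i}. - (c $ m) + c $ l) * u i = 0" if "i \<noteq> m" for i
        using that prod.remove[of "UNIV - {i}" m "\<lambda>l. - (c $ m) + c $ l"] by simp
      then have "(\<Sum>i\<in>UNIV. (\<Prod>l\<in>UNIV-{i}. - (c $ m) + c $ l) * u i) = (\<Prod>l\<in>UNIV-{m}. - (c $ m) + c $ l) * u m"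
        by (subst sum.remove[of _ m], simp, simp, subst sum.neutral) (blast, simp)
      then have "(\<Prod>l\<in>UNIV-{m}. - (c $ m) + c $ l) * u m = 0" using eval0 by metis
      moreover have "(\<Prod>l\<in>UNIV-{m}. - (c $ m) + c $ l) \<noteq> 0"
        using cinj by auto
      ultimately show ?thesis using sin_pos[of m] by (simp add: u_def)
    qed
    then show "w = 0" by (simp add: vec_eq_iff)
  qed
  then have "invertible (jac_mat x)"
    by (simp add: invertible_left_inverse matrix_left_invertible_ker)
  then show ?thesis by (simp add: jac_det_eq invertible_det_nz)
qed

section \<open>Injectivity of phi on the fundamental domain\<close>

lemma proots_prod_linear:
  fixes c :: "real^'n::finite"
  shows "proots (\<Prod>i\<in>UNIV. [:c $ i, 1:]) = image_mset (\<lambda>i. - (c $ i)) (mset_set UNIV)"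
proof -
  have "proots (\<Prod>i\<in>UNIV. [:c $ i, 1:]) = (\<Sum>i\<in>UNIV. {#- (c $ i)#})"
    by (subst proots_prod) auto
  also have "\<dots> = image_mset (\<lambda>i. - (c $ i)) (mset_set UNIV)"
    by (simp add: sum_unfold_sum_mset)
  finally show ?thesis .
qed

text \<open>
  The elementary symmetric polynomials determine \<open>\<Prod>\<^sub>i (t + c_i)\<close>, hence the multiset of its roots.
\<close>

lemma esym_eq_imp_image_mset_eq:
  fixes c d :: "real^'n::finite"
  assumes "\<And>k. k \<le> CARD('n) \<Longrightarrow> esym UNIV c k = esym UNIV d k"
  shows "image_mset (\<lambda>i. c $ i) (mset_set UNIV) = image_mset (\<lambda>i. d $ i) (mset_set UNIV)"
proof -
  have "poly (\<Prod>i\<in>UNIV. [:c $ i, 1:]) t = poly (\<Prod>i\<in>UNIV. [:d $ i, 1:]) t" for t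
    using prod_add_esym[of t c UNIV] prod_add_esym[of t d UNIV] assms
    by (simp add: poly_prod add.commute)
  then have "(\<Prod>i\<in>UNIV. [:c $ i, 1:]) = (\<Prod>i\<in>UNIV. [:d $ i, 1:])"
    using poly_eq_poly_eq_iff by blast
  then have "image_mset uminus (image_mset (\<lambda>i. - (c $ i)) (mset_set UNIV))
           = image_mset uminus (image_mset (\<lambda>i. - (d $ i)) (mset_set UNIV))"
    by (metis proots_prod_linear)
  then show ?thesis by (simp add: image_mset.compositionality comp_def)
qed

text \<open>
  For a monotone vector the sets \<open>{i. c_i \<le> a}\<close> are initial segments, and initial segments of equal
  size coincide.
\<close>

lemma mono_image_mset_eq:
  fixes c d :: "real^'n::{finite,wellorder}"
  assumes eq: "image_mset (\<lambda>i. c $ i) (mset_set UNIV) = image_mset (\<lambda>i. d $ i) (mset_set UNIV)"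
    and mono: "mono (($) c)" "mono (($) d)"
  shows "c = d"
proof -
  have count: "card {i. e $ i \<le> a} = size (filter_mset (\<lambda>z. z \<le> a) (image_mset (\<lambda>i. e $ i) (mset_set UNIV)))"
    for e :: "real^'n::_" and a
    by (simp add: filter_mset_image_mset)
  have iff: "c $ i \<le> a \<longleftrightarrow> d $ i \<le> a" for i a
  proof -
    let ?C = "{i. c $ i \<le> a}" and ?D = "{i. d $ i \<le> a}"
    have card: "card ?C = card ?D" by (simp only: count eq)
    have "?C \<subseteq> ?D \<or> ?D \<subseteq> ?C"
      using monoD[OF mono(1)] monoD[OF mono(2)] by (smt (verit) linear mem_Collect_eq order_trans subsetI)
    then have "?C = ?D" using card by (metis card_subset_eq finite)
    then show ?thesis by blast
  qed
  have "c $ i = d $ i" for i using iff[of i "c $ i"] iff[of i "d $ i"] by simp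
  then show ?thesis by (simp add: vec_eq_iff)
qed

lemma cos_vec_mono:
  assumes "x \<in> fund_dom" shows "mono (($) (cos_vec x))"
proof (rule monoI)
  fix i j :: 'a assume "i \<le> j"
  then have "x $ j \<le> x $ i" "0 \<le> x $ j" "x $ i \<le> 1" using assms by (auto simp: fund_dom_def)
  then show "cos_vec x $ i \<le> cos_vec x $ j"
    unfolding cos_vec_def vec_lambda_beta by (intro cos_monotone_0_pi_le) auto
qed

lemma inj_on_phi: "inj_on phi (fund_dom :: (real^'n::{finite,wellorder}) set)"
proof (rule inj_onI)
  fix x y :: "real^'n::_"
  assume xy: "x \<in> fund_dom" "y \<in> fund_dom" and eq: "phi x = phi y"
  have "esym UNIV (cos_vec x) k = esym UNIV (cos_vec y) k" if le: "k \<le> CARD('n)" for k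
  proof (cases "k = 0")
    case False
    then obtain j :: 'n where j: "card {..j} = k" using ex_rank[where 'n='n, of k] le by auto
    have "phi x $ j = phi y $ j" using eq by simp
    then show ?thesis using X_factor_pos[of j] by (simp add: phi_def X_var_esym j)
  qed (simp add: esym_0)
  then have "cos_vec x = cos_vec y"
    using esym_eq_imp_image_mset_eq mono_image_mset_eq cos_vec_mono xy by blast
  then have "cos (pi * x $ i) = cos (pi * y $ i)" for i
    by (simp add: cos_vec_def vec_eq_iff)
  then have "pi * x $ i = pi * y $ i" for i
    by (rule cos_inj_pi[rotated -1]) (use xy in \<open>auto simp: fund_dom_def\<close>)
  then show "x = y" by (simp add: vec_eq_iff)
qed

section \<open>Symmetry under permutations of the coordinates\<close>

lemma permute_vec_nth [simp]: "permute_vec \<sigma> x $ i = x $ \<sigma> i"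
  by (simp add: permute_vec_def)

lemma permute_vec_comp: "permute_vec \<sigma> (permute_vec \<tau> x) = permute_vec (\<tau> \<circ> \<sigma>) x"
  by (simp add: vec_eq_iff)

lemma permute_vec_inv:
  assumes "\<sigma> permutes UNIV"
  shows "permute_vec \<sigma> (permute_vec (Hilbert_Choice.inv \<sigma>) x) = x"
    "permute_vec (Hilbert_Choice.inv \<sigma>) (permute_vec \<sigma> x) = x"
  using permutes_inverses[OF assms] by (simp_all add: vec_eq_iff)

lemma cos_plus_permute:
  assumes "\<sigma> permutes UNIV"
  shows "cos_plus l (permute_vec \<sigma> x) = cos_plus l x"
proof -
  have "(\<Prod>i\<in>UNIV. cos (pi * l $ (\<tau> \<circ> \<sigma>) i * permute_vec \<sigma> x $ i)) = (\<Prod>i\<in>UNIV. cos (pi * l $ \<tau> i * x $ i))" for \<tau>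
    using prod.permute[OF assms, of "\<lambda>i. cos (pi * l $ \<tau> i * x $ i)"] by (simp add: comp_def)
  then show ?thesis
    unfolding cos_plus_def by (subst sum_permutations_compose_right[OF assms]) simp
qed

lemma phi_permute: "\<sigma> permutes UNIV \<Longrightarrow> phi (permute_vec \<sigma> x) = phi x"
  by (simp add: phi_def X_var_def cos_plus_permute)

lemma ex_antimono_permutes:
  fixes x :: "real^'n::{finite,wellorder}"
  shows "\<exists>\<sigma>. \<sigma> permutes UNIV \<and> (\<forall>i j. i \<le> j \<longrightarrow> x $ \<sigma> j \<le> x $ \<sigma> i)"
proof -
  define xs where "xs = sorted_list_of_set (UNIV :: 'n set)"
  define ys where "ys = sort_key (\<lambda>i. - (x $ i)) xs"
  have xs: "distinct xs" "set xs = UNIV" "sorted_wrt (<) xs" "length xs = CARD('n)"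
    by (simp_all add: xs_def)
  have ys: "distinct ys" "set ys = UNIV" "length ys = CARD('n)" "sorted (map (\<lambda>i. - (x $ i)) ys)"
    using xs by (simp_all add: ys_def)
  have rho_bij: "bij_betw (nth xs) {..<CARD('n)} UNIV" "bij_betw (nth ys) {..<CARD('n)} UNIV"
    using bij_betw_nth[OF xs(1) refl] bij_betw_nth[OF ys(1) refl] xs ys by simp_all
  define r where "r = the_inv_into {..<CARD('n)} (nth xs)"
  have r: "bij_betw r UNIV {..<CARD('n)}"
    unfolding r_def by (rule bij_betw_the_inv_into[OF rho_bij(1)])
  have nth_r: "xs ! r i = i" for i
    unfolding r_def using rho_bij(1) by (intro f_the_inv_into_f_bij_betw[of _ _ UNIV]) auto
  have r_less: "r i < CARD('n)" for i using r by (auto simp: bij_betw_def)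
  have r_mono: "r i \<le> r j" if "i \<le> j" for i j
  proof (rule ccontr)
    assume "\<not> r i \<le> r j"
    then have "xs ! r j < xs ! r i"
      using xs(3,4) r_less by (intro sorted_wrt_nth_less[of "(<)"]) auto
    then show False using that by (simp add: nth_r)
  qed
  have "bij_betw (\<lambda>i. ys ! r i) UNIV UNIV"
    using bij_betw_trans[OF r rho_bij(2)] by (simp add: comp_def)
  then have "(\<lambda>i. ys ! r i) permutes UNIV" by (intro bij_imp_permutes) auto
  moreover have "x $ (ys ! r j) \<le> x $ (ys ! r i)" if "i \<le> j" for i j
    using sorted_nth_mono[OF ys(4) r_mono[OF that]] r_less[of i] r_less[of j] ys(3) by simp
  ultimately show ?thesis by blast
qed

lemma permute_vec_cbox:
  fixes x :: "real^'n::{finite,wellorder}"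
  assumes "\<sigma> permutes UNIV"
  shows "permute_vec \<sigma> x \<in> cbox 0 1 \<longleftrightarrow> x \<in> cbox 0 1"
  using assms by (auto simp: mem_box_cart) (metis permutes_inverses(1))+

lemma fund_dom_subset: "fund_dom \<subseteq> (cbox 0 1 :: (real^'n::{finite,wellorder}) set)"
  by (auto simp: fund_dom_def mem_box_cart)

lemma ex_permute_fund_dom:
  fixes x :: "real^'n::{finite,wellorder}"
  assumes "x \<in> cbox 0 1"
  shows "\<exists>\<sigma>. \<sigma> permutes UNIV \<and> permute_vec \<sigma> x \<in> fund_dom"
  using ex_antimono_permutes[of x] assms by (auto simp: fund_dom_def mem_box_cart)

text \<open>
  Since \<open>phi\<close> is symmetric and injective on \<open>fund_dom\<close>, an orbit meets \<open>fund_dom\<close> in one point only;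
  the permutations reaching it form a coset of its stabilizer.
\<close>

lemma card_permute_fund_dom:
  fixes x :: "real^'n::{finite,wellorder}"
  assumes \<sigma>: "\<sigma> permutes UNIV" and s: "permute_vec \<sigma> x \<in> fund_dom"
  shows "card {\<tau>. \<tau> permutes UNIV \<and> permute_vec \<tau> x \<in> fund_dom} = stab_card (permute_vec \<sigma> x)"
proof -
  define s where "s = permute_vec \<sigma> x"
  have x: "x = permute_vec (Hilbert_Choice.inv \<sigma>) s"
    by (simp only: s_def permute_vec_inv(2)[OF \<sigma>])
  have comp: "permute_vec (Hilbert_Choice.inv \<sigma> \<circ> \<tau>) s = permute_vec \<tau> x" for \<tau>
    by (subst x) (simp only: permute_vec_comp)
  have "permute_vec \<tau> x \<in> fund_dom \<longleftrightarrow> permute_vec (Hilbert_Choice.inv \<sigma> \<circ> \<tau>) s = s"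
    if "\<tau> permutes UNIV" for \<tau>
  proof
    assume "permute_vec \<tau> x \<in> fund_dom"
    moreover have "phi (permute_vec \<tau> x) = phi s"
      using \<sigma> that by (simp add: s_def phi_permute)
    ultimately have "permute_vec \<tau> x = s"
      using inj_on_phi s unfolding s_def inj_on_def by blast
    then show "permute_vec (Hilbert_Choice.inv \<sigma> \<circ> \<tau>) s = s"
      by (simp only: comp)
  next
    assume "permute_vec (Hilbert_Choice.inv \<sigma> \<circ> \<tau>) s = s"
    then show "permute_vec \<tau> x \<in> fund_dom"
      unfolding comp using s by (simp add: s_def)
  qed
  then have "{\<tau>. \<tau> permutes UNIV \<and> permute_vec \<tau> x \<in> fund_dom}
      = {\<tau>. \<tau> permutes UNIV \<and> permute_vec (Hilbert_Choice.inv \<sigma> \<circ> \<tau>) s = s}" by blast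
  also have "bij_betw ((\<circ>) (Hilbert_Choice.inv \<sigma>)) \<dots> {\<tau>. \<tau> permutes UNIV \<and> permute_vec \<tau> s = s}"
  proof (rule bij_betw_byWitness[where f' = "(\<circ>) \<sigma>"])
  qed (use \<sigma> permutes_inv_o[OF \<sigma>] in \<open>auto simp: o_assoc intro: permutes_compose permutes_inv\<close>)
  then have "card {\<tau>. \<tau> permutes UNIV \<and> permute_vec (Hilbert_Choice.inv \<sigma> \<circ> \<tau>) s = s} = stab_card s"
    unfolding stab_card_def permute_vec_def by (rule bij_betw_same_card)
  finally show ?thesis by (simp add: s_def)
qed

lemma stab_card_pos: "stab_card s > 0"
proof -
  have "finite {\<sigma>::'a\<Rightarrow>'a. \<sigma> permutes UNIV \<and> (\<chi> i. s $ \<sigma> i) = s}"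
    by (rule finite_subset[OF _ finite_permutations[of UNIV]]) auto
  moreover have "id \<in> {\<sigma>::'a\<Rightarrow>'a. \<sigma> permutes UNIV \<and> (\<chi> i. s $ \<sigma> i) = s}" by (simp add: permutes_id)
  ultimately show ?thesis unfolding stab_card_def by (metis card_gt_0_iff empty_iff)
qed

lemma finite_labels:
  assumes "finite I" shows "finite {r::'b^'n::finite. \<forall>i. r $ i \<in> I}"
proof (rule finite_subset)
  show "{r::'b^'n. \<forall>i. r $ i \<in> I} \<subseteq> vec_lambda ` (PiE UNIV (\<lambda>_. I))"
    by (rule subsetI, rule_tac x = "vec_nth x" in image_eqI) auto
qed (use assms in \<open>auto intro!: finite_PiE\<close>)

text \<open>
  Each label in the full box is counted once for every permutation that sorts it, and the weight
  \<open>1 / stab_card\<close> compensates for the number of such permutations.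
\<close>

lemma sum_labels_symmetric:
  fixes t :: "'b \<Rightarrow> real" and g :: "'b^'n::{finite,wellorder} \<Rightarrow> real"
  assumes fin: "finite I" and t: "\<And>a. a \<in> I \<Longrightarrow> 0 \<le> t a \<and> t a \<le> 1"
    and sym: "\<And>\<sigma> r. \<sigma> permutes UNIV \<Longrightarrow> g (permute_vec \<sigma> r) = g r"
  defines "pt \<equiv> \<lambda>r::'b^'n::_. \<chi> i. t (r $ i)"
  shows "(\<Sum>r | \<forall>i. r $ i \<in> I. g r)
       = fact CARD('n) * (\<Sum>r | (\<forall>i. r $ i \<in> I) \<and> pt r \<in> fund_dom. g r / stab_card (pt r))"
proof -
  let ?R = "{r::'b^'n::_. \<forall>i. r $ i \<in> I}" and ?P = "{\<sigma>::'n \<Rightarrow> 'n. \<sigma> permutes UNIV}"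
  let ?h = "\<lambda>r. if pt r \<in> fund_dom then g r / stab_card (pt r) else 0"
  have fP: "finite ?P" by (rule finite_permutations) simp
  have fR: "finite ?R" using fin by (rule finite_labels)
  have pt_perm: "pt (permute_vec \<sigma> r) = permute_vec \<sigma> (pt r)" for \<sigma> r
    by (simp add: pt_def vec_eq_iff)
  have "g r = (\<Sum>\<sigma>\<in>?P. ?h (permute_vec \<sigma> r))" if r: "r \<in> ?R" for r
  proof -
    have "pt r \<in> cbox 0 1" using r t by (auto simp: pt_def mem_box_cart)
    then obtain \<sigma> where \<sigma>: "\<sigma> permutes UNIV" "permute_vec \<sigma> (pt r) \<in> fund_dom"
      using ex_permute_fund_dom by blast
    have stab: "stab_card (permute_vec \<tau> (pt r)) = card {\<tau>. \<tau> permutes UNIV \<and> permute_vec \<tau> (pt r) \<in> fund_dom}"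
      if "\<tau> permutes UNIV" "permute_vec \<tau> (pt r) \<in> fund_dom" for \<tau>
      using card_permute_fund_dom[OF that] by simp
    have "(\<Sum>\<sigma>\<in>?P. ?h (permute_vec \<sigma> r)) = (\<Sum>\<sigma> | \<sigma> permutes UNIV \<and> permute_vec \<sigma> (pt r) \<in> fund_dom.
         g r / card {\<tau>. \<tau> permutes UNIV \<and> permute_vec \<tau> (pt r) \<in> fund_dom})"
      using fP by (intro sum.mono_neutral_cong_right) (auto simp: pt_perm sym stab)
    also have "\<dots> = g r"
    proof -
      define H where "H = card {\<tau>. \<tau> permutes UNIV \<and> permute_vec \<tau> (pt r) \<in> fund_dom}"
      have "H > 0" unfolding H_def stab[OF \<sigma>, symmetric] by (rule stab_card_pos)
      then show ?thesis unfolding sum_constant H_def[symmetric] by simp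
    qed
    finally show ?thesis by simp
  qed
  then have "(\<Sum>r\<in>?R. g r) = (\<Sum>r\<in>?R. \<Sum>\<sigma>\<in>?P. ?h (permute_vec \<sigma> r))"
    by (intro sum.cong refl) blast
  also have "\<dots> = (\<Sum>\<sigma>\<in>?P. \<Sum>r\<in>?R. ?h (permute_vec \<sigma> r))" by (rule sum.swap)
  also have "\<dots> = (\<Sum>\<sigma>\<in>?P. \<Sum>r\<in>?R. ?h r)"
  proof (rule sum.cong[OF refl])
    fix \<sigma> :: "'n \<Rightarrow> 'n" assume "\<sigma> \<in> ?P"
    then have \<sigma>: "\<sigma> permutes UNIV" by simp
    show "(\<Sum>r\<in>?R. ?h (permute_vec \<sigma> r)) = (\<Sum>r\<in>?R. ?h r)"
      using permute_vec_inv[OF \<sigma>]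
      by (intro sum.reindex_bij_witness[of _ "permute_vec (Hilbert_Choice.inv \<sigma>)" "permute_vec \<sigma>"]) auto
  qed
  also have "\<dots> = fact CARD('n) * (\<Sum>r\<in>?R. ?h r)"
    by (simp add: card_permutations)
  also have "(\<Sum>r\<in>?R. ?h r) = (\<Sum>r | (\<forall>i. r $ i \<in> I) \<and> pt r \<in> fund_dom. g r / stab_card (pt r))"
    using fR by (intro sum.mono_neutral_cong_right) auto
  finally show ?thesis .
qed

section \<open>Integrals over the cube and over the fundamental domain\<close>

lemma prod_Basis_cart:
  "(\<Prod>b\<in>(Basis :: (real^'n) set). f b) = (\<Prod>i\<in>UNIV. f (axis i 1))"
proof -
  have 1: "(Basis :: (real^'n) set) = range (\<lambda>i. axis i 1)" by (auto simp: Basis_vec_def)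
  have 2: "inj (\<lambda>i. axis i (1::real) :: real^'n)" by (auto simp: inj_def axis_eq_axis)
  show ?thesis unfolding 1 prod.reindex[OF 2] by (simp add: comp_def)
qed

lemma integral_lborel_prod_cart:
  fixes f :: "'n::finite \<Rightarrow> real \<Rightarrow> real"
  assumes "\<And>i. integrable lborel (f i)"
  shows "(\<integral>x. (\<Prod>i\<in>UNIV. f i (x $ i)) \<partial>(lborel :: (real^'n) measure)) = (\<Prod>i\<in>UNIV. \<integral>x. f i x \<partial>lborel)"
proof -
  interpret product_sigma_finite "\<lambda>_::real^'n. lborel :: real measure" by standard
  define F where "F b = f (THE i. b = axis i 1)" for b :: "real^'n"
  have F: "F (axis i 1) = f i" for i by (simp add: F_def axis_eq_axis)
  have [measurable]: "f i \<in> borel_measurable borel" for i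
    using borel_measurable_integrable[OF assms[of i]] by simp
  have Fint: "integrable lborel (F b)" if "b \<in> Basis" for b
    using that assms F by (auto simp: Basis_vec_def)
  have prodF: "(\<Prod>i\<in>UNIV. f i (x $ i)) = (\<Prod>b\<in>Basis. F b (x \<bullet> b))" for x :: "real^'n"
    by (simp add: prod_Basis_cart F inner_axis)
  have "(\<integral>x. (\<Prod>i\<in>UNIV. f i (x $ i)) \<partial>(lborel :: (real^'n) measure))
      = (\<integral>g. (\<Prod>i\<in>UNIV. f i ((\<Sum>b\<in>Basis. g b *\<^sub>R b) $ i)) \<partial>(\<Pi>\<^sub>M b\<in>(Basis :: (real^'n) set). lborel))"
    by (subst lborel_eq, subst integral_distr) auto
  also have "\<dots> = (\<integral>g. (\<Prod>b\<in>(Basis :: (real^'n) set). F b (g b)) \<partial>(\<Pi>\<^sub>M b\<in>(Basis :: (real^'n) set). lborel))"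
    unfolding prodF by (intro Bochner_Integration.integral_cong refl prod.cong) (simp add: inner_sum_left_Basis)
  also have "\<dots> = (\<Prod>b\<in>Basis. \<integral>x. F b x \<partial>lborel)"
    by (rule product_integral_prod) (auto intro: Fint)
  also have "\<dots> = (\<Prod>i\<in>UNIV. \<integral>x. f i x \<partial>lborel)"
    by (simp add: prod_Basis_cart F)
  finally show ?thesis .
qed

lemma measurable_permute_vec [measurable]: "permute_vec \<sigma> \<in> borel_measurable (borel :: (real^'n::finite) measure)"
proof -
  have "continuous_on UNIV (permute_vec \<sigma> :: real^'n \<Rightarrow> real^'n)"
    unfolding permute_vec_def by (intro continuous_intros)
  then show ?thesis by (rule borel_measurable_continuous_onI)
qed

lemma lborel_distr_permute_vec:
  assumes \<sigma>: "\<sigma> permutes (UNIV :: 'n::finite set)"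
  shows "distr lborel borel (permute_vec \<sigma>) = (lborel :: (real^'n) measure)"
proof (rule lborel_eqI[symmetric])
  fix l u :: "real^'n" assume le: "\<And>b. b \<in> Basis \<Longrightarrow> l \<bullet> b \<le> u \<bullet> b"
  then have le': "l $ i \<le> u $ i" for i
    using le[of "axis i 1"] by (simp add: inner_axis)
  let ?\<rho> = "Hilbert_Choice.inv \<sigma>"
  have "permute_vec \<sigma> -` box l u = box (permute_vec ?\<rho> l) (permute_vec ?\<rho> u)"
    using permutes_inverses[OF \<sigma>] by (auto simp: mem_box_cart) metis+
  then have "emeasure (distr lborel borel (permute_vec \<sigma>)) (box l u)
      = emeasure lborel (box (permute_vec ?\<rho> l) (permute_vec ?\<rho> u))"
    by (subst emeasure_distr) auto
  also have "\<dots> = ennreal (\<Prod>i\<in>UNIV. (u - l) $ ?\<rho> i)"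
    using le' by (subst emeasure_lborel_box) (auto simp: prod_Basis_cart inner_axis, auto simp: Basis_vec_def inner_axis)
  also have "(\<Prod>i\<in>UNIV. (u - l) $ ?\<rho> i) = (\<Prod>i\<in>UNIV. (u - l) $ i)"
    using prod.permute[OF permutes_inv[OF \<sigma>], of "\<lambda>i. (u - l) $ i"] by (simp add: comp_def)
  finally show "emeasure (distr lborel borel (permute_vec \<sigma>)) (box l u) = (\<Prod>b\<in>Basis. (u - l) \<bullet> b)"
    by (simp add: prod_Basis_cart inner_axis)
qed simp

lemma fund_dom_closed: "closed (fund_dom :: (real^'n::{finite,wellorder}) set)"
proof -
  have eq: "fund_dom = (\<Inter>i. {x::real^'n::_. 0 \<le> x $ i}) \<inter> (\<Inter>i. {x. x $ i \<le> 1})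
      \<inter> (\<Inter>i. \<Inter>j\<in>{i..}. {x. x $ j \<le> x $ i})"
    by (auto simp: fund_dom_def)
  show ?thesis unfolding eq
    by (intro closed_Int closed_INT ballI closed_Collect_le continuous_intros)
qed

lemma fund_dom_compact: "compact (fund_dom :: (real^'n::{finite,wellorder}) set)"
  using fund_dom_closed fund_dom_subset by (metis bounded_cbox bounded_subset compact_eq_bounded_closed)

lemma fund_dom_borel [measurable]: "fund_dom \<in> sets borel"
  using fund_dom_closed by (rule borel_closed)

lemma negligible_UN_finite:
  "finite I \<Longrightarrow> (\<And>i. i \<in> I \<Longrightarrow> negligible (S i)) \<Longrightarrow> negligible (\<Union>i\<in>I. S i)"
  by (rule negligible_Union) auto

lemma negligible_equal_coords: "negligible {x::real^'n::finite. \<not> inj (($) x)}"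
proof -
  have "{x :: real^'n. \<not> inj (($) x)} \<subseteq> (\<Union>i. \<Union>j\<in>-{i}. {x. (axis i 1 - axis j 1) \<bullet> x = 0})"
    by (auto simp: inj_def inner_diff_left inner_axis') (metis Compl_iff singletonD)
  moreover have "negligible (\<Union>i. \<Union>j\<in>-{i}. {x :: real^'n. (axis i 1 - axis j 1) \<bullet> x = 0})"
    by (intro negligible_UN_finite finite ballI negligible_hyperplane) (auto simp: axis_eq_axis)
  ultimately show ?thesis using negligible_subset by blast
qed

text \<open>
  Almost every point of the cube has distinct coordinates and is sorted by exactly one permutation, so
  the cube consists, up to a null set, of \<open>n!\<close> permuted copies of \<open>fund_dom\<close>.
\<close>

lemma integral_cube_symmetric:
  fixes G :: "real^'n::{finite,wellorder} \<Rightarrow> real"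
  assumes cont: "continuous_on UNIV G"
    and sym: "\<And>\<sigma> x. \<sigma> permutes UNIV \<Longrightarrow> G (permute_vec \<sigma> x) = G x"
  shows "(LINT x:cbox 0 1|lborel. G x) = fact CARD('n) * (LINT x:fund_dom|lborel. G x)"
proof -
  let ?P = "{\<sigma>::'n \<Rightarrow> 'n. \<sigma> permutes UNIV}"
  have fP: "finite ?P" by (rule finite_permutations) simp
  define h where "h x = indicator fund_dom x * G x" for x
  have Gm [measurable]: "G \<in> borel_measurable borel" using cont by (rule borel_measurable_continuous_onI)
  have hm [measurable]: "h \<in> borel_measurable borel" unfolding h_def by measurable
  have hint: "integrable lborel h"
    using borel_integrable_compact[OF fund_dom_compact continuous_on_subset[OF cont subset_UNIV]]
    by (simp add: h_def[abs_def] indicator_times_eq_if mult_ac)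
  have hp: "integrable lborel (\<lambda>x. h (permute_vec \<sigma> x))" "(\<integral>x. h (permute_vec \<sigma> x) \<partial>lborel) = (\<integral>x. h x \<partial>lborel)"
    if "\<sigma> permutes UNIV" for \<sigma>
  proof -
    show "integrable lborel (\<lambda>x. h (permute_vec \<sigma> x))"
      using hint integrable_distr[of "permute_vec \<sigma>" lborel borel h] lborel_distr_permute_vec[OF that] by simp
    show "(\<integral>x. h (permute_vec \<sigma> x) \<partial>lborel) = (\<integral>x. h x \<partial>lborel)"
      using integral_distr[of "permute_vec \<sigma>" lborel borel h] lborel_distr_permute_vec[OF that] by simp
  qed
  have "AE x in lebesgue. inj (($) (x :: real^'n::_))"
    by (rule AE_I'[of "{x. \<not> inj (($) x)}"])
       (use negligible_equal_coords in \<open>auto simp: negligible_iff_null_sets\<close>)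
  then have AE_distinct: "AE x in lborel. inj (($) (x :: real^'n::_))"
    by (simp add: AE_completion_iff)
  have "AE x in lborel. indicator (cbox 0 1) x *\<^sub>R G x = (\<Sum>\<sigma>\<in>?P. h (permute_vec \<sigma> x))"
    using AE_distinct
  proof (rule eventually_mono)
    fix x :: "real^'n::_" assume inj: "inj (($) x)"
    have "(\<Sum>\<sigma>\<in>?P. h (permute_vec \<sigma> x)) = (\<Sum>\<sigma>\<in>?P. if permute_vec \<sigma> x \<in> fund_dom then G x else 0)"
      by (intro sum.cong refl) (auto simp: h_def sym)
    also have "\<dots> = card {\<sigma>. \<sigma> permutes UNIV \<and> permute_vec \<sigma> x \<in> fund_dom} * G x"
      using fP by (simp add: sum.If_cases Int_def)
    also have "\<dots> = indicator (cbox 0 1) x *\<^sub>R G x"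
    proof (cases "x \<in> cbox 0 1")
      case True
      then obtain \<sigma> where \<sigma>: "\<sigma> permutes UNIV" "permute_vec \<sigma> x \<in> fund_dom"
        using ex_permute_fund_dom by blast
      have "{\<tau>. \<tau> permutes UNIV \<and> (\<chi> i. permute_vec \<sigma> x $ \<tau> i) = permute_vec \<sigma> x} = {id}"
        using injD[OF inj] injD[OF permutes_inj[OF \<sigma>(1)]] by (auto simp: vec_eq_iff permutes_id fun_eq_iff)
      then show ?thesis
        using card_permute_fund_dom[OF \<sigma>] True by (simp add: stab_card_def)
    next
      case False
      then have no: "\<not> (\<sigma> permutes UNIV \<and> permute_vec \<sigma> x \<in> fund_dom)" for \<sigma>
        using permute_vec_cbox[of \<sigma> x] fund_dom_subset by blast
      show ?thesis using False by (simp add: no)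
    qed
    finally show "indicator (cbox 0 1) x *\<^sub>R G x = (\<Sum>\<sigma>\<in>?P. h (permute_vec \<sigma> x))" by simp
  qed
  then have "(LINT x:cbox 0 1|lborel. G x) = (\<integral>x. (\<Sum>\<sigma>\<in>?P. h (permute_vec \<sigma> x)) \<partial>lborel)"
    unfolding set_lebesgue_integral_def by (intro integral_cong_AE) auto
  also have "\<dots> = (\<Sum>\<sigma>\<in>?P. \<integral>x. h (permute_vec \<sigma> x) \<partial>lborel)"
    by (rule Bochner_Integration.integral_sum) (auto intro: hp)
  also have "\<dots> = fact CARD('n) * (\<integral>x. h x \<partial>lborel)"
    by (simp add: hp card_permutations)
  finally show ?thesis
    by (simp add: set_lebesgue_integral_def h_def[abs_def])
qed

section \<open>Change of variables\<close>

lemma continuous_phi: "continuous_on S phi"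
  using phi_has_derivative has_derivative_continuous by (metis continuous_at_imp_continuous_on)

lemma continuous_rpoly_eval: "continuous_on S (rpoly_eval p)"
  unfolding rpoly_eval_def[abs_def] by (intro continuous_intros)

lemma borel_rpoly_eval [measurable]: "rpoly_eval p \<in> borel_measurable borel"
  by (rule borel_measurable_continuous_onI[OF continuous_rpoly_eval])

lemma negligible_jac_det_zero: "negligible {x \<in> fund_dom. jac_det (x :: real^'n::{finite,wellorder}) = 0}"
proof -
  have "negligible {x::real^'n::_. \<not> inj (($) x)}" by (rule negligible_equal_coords)
  moreover have "negligible {x :: real^'n::_. x $ i = c}" for i c
    using negligible_hyperplane[of "axis i 1 :: real^'n::_" c] by (simp add: inner_axis' axis_eq_0_iff)
  then have "negligible (\<Union>i. {x :: real^'n::_. x $ i = 0})" "negligible (\<Union>i. {x :: real^'n::_. x $ i = 1})"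
    by (intro negligible_UN_finite finite; simp)+
  ultimately have "negligible ({x::real^'n::_. \<not> inj (($) x)} \<union> (\<Union>i. {x. x $ i = 0}) \<union> (\<Union>i. {x. x $ i = 1}))"
    by (intro negligible_Un)
  moreover have "{x \<in> fund_dom. jac_det (x :: real^'n::_) = 0}
     \<subseteq> {x::real^'n::_. \<not> inj (($) x)} \<union> (\<Union>i. {x. x $ i = 0}) \<union> (\<Union>i. {x. x $ i = 1})"
  proof
    fix x :: "real^'n::_" assume x: "x \<in> {x \<in> fund_dom. jac_det x = 0}"
    show "x \<in> {x::real^'n::_. \<not> inj (($) x)} \<union> (\<Union>i. {x. x $ i = 0}) \<union> (\<Union>i. {x. x $ i = 1})"
    proof (rule ccontr)
      assume "\<not> ?thesis"
      then have "inj (($) x)" "\<And>i. x $ i \<noteq> 0" "\<And>i. x $ i \<noteq> 1" by auto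
      moreover have "0 \<le> x $ i" "x $ i \<le> 1" for i using x by (auto simp: fund_dom_def)
      ultimately have "jac_det x \<noteq> 0" by (intro jac_det_nonzero) (auto simp: less_le)
      then show False using x by simp
    qed
  qed
  ultimately show ?thesis using negligible_subset by blast
qed

text \<open>
  The substitution \<open>Y = phi x\<close> produces the factor \<open>\<bar>jac_det x\<bar> = cal_J (phi x)\<close>, which cancels the denominator
  of \<open>omega_III\<close> wherever the Jacobian does not vanish.
\<close>

lemma integral_phi_dom:
  fixes f :: "('n::{finite,wellorder}) rpoly"
  defines "G \<equiv> \<lambda>x. rpoly_eval f (phi x) * (cos_plus (\<chi> i. 1 / 2) x)\<^sup>2"
  shows "set_integrable lborel phi_dom (\<lambda>Y. rpoly_eval f Y * omega_III Y)"
    "(LINT Y:phi_dom|lborel. rpoly_eval f Y * omega_III Y) = (LINT x:fund_dom|lborel. G x)"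
proof -
  define h where "h Y = rpoly_eval f Y * omega_III Y" for Y
  have Gcont: "continuous_on S G" for S
    unfolding G_def cos_rho_square cos_vec_def vec_lambda_beta
    by (intro continuous_intros continuous_on_compose2[OF continuous_rpoly_eval[of UNIV] continuous_phi]) auto
  have GintL: "set_integrable lborel fund_dom G"
    using borel_integrable_compact[OF fund_dom_compact Gcont] 
    by (simp add: set_integrable_def indicator_times_eq_if)
  have Gint: "G absolutely_integrable_on fund_dom"
    using GintL unfolding set_integrable_def by (rule integrable_completion[THEN iffD2, rotated]) 
       (use GintL in \<open>simp add: set_integrable_def borel_measurable_integrable\<close>)
  have eq: "\<bar>det (matrix ((*v) (jac_mat x)))\<bar> * h (phi x) = G x" if "x \<in> fund_dom - {x \<in> fund_dom. jac_det x = 0}" for x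
    using that by (simp add: h_def omega_III_def cal_J_phi J_III_phi G_def jac_det_eq)
  have der: "(phi has_derivative (*v) (jac_mat x)) (at x within fund_dom)" for x :: "real^'n::_"
    by (rule has_derivative_at_withinI[OF phi_has_derivative])
  have "(\<lambda>x. \<bar>det (matrix ((*v) (jac_mat x)))\<bar> * h (phi x)) absolutely_integrable_on fund_dom"
    by (rule absolutely_integrable_spike[OF Gint negligible_jac_det_zero eq])
  moreover have "integral fund_dom (\<lambda>x. \<bar>det (matrix ((*v) (jac_mat x)))\<bar> * h (phi x)) = integral fund_dom G"
    by (rule integral_spike[OF negligible_jac_det_zero eq[symmetric]])
  \<comment> \<open>Real-valued integrands are read as \<open>real^1\<close>-valued ones, for which the substitution rule is stated.\<close>
  moreover have "(\<lambda>x. \<bar>det (matrix ((*v) (jac_mat x)))\<bar> *\<^sub>R (vec (h (phi x)) :: real^1)) absolutely_integrable_on fund_dom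
      \<and> integral fund_dom (\<lambda>x. \<bar>det (matrix ((*v) (jac_mat x)))\<bar> *\<^sub>R (vec (h (phi x)) :: real^1)) = (vec (integral fund_dom G) :: real^1)
     \<longleftrightarrow> (\<lambda>Y. vec (h Y) :: real^1) absolutely_integrable_on (phi ` fund_dom)
      \<and> integral (phi ` fund_dom) (\<lambda>Y. vec (h Y) :: real^1) = vec (integral fund_dom G)"
    by (rule has_absolute_integral_change_of_variables_compact[OF fund_dom_compact der inj_on_phi])
  ultimately have h: "h absolutely_integrable_on phi_dom" "integral phi_dom h = integral fund_dom G"
    by (simp_all add: absolutely_integrable_on_1_iff integral_on_1_eq phi_dom_def vec_eq_iff)
  have "compact (phi_dom :: (real^'n::_) set)"
    unfolding phi_dom_def by (rule compact_continuous_image[OF continuous_phi fund_dom_compact])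
  then have [measurable]: "phi_dom \<in> sets (borel :: (real^'n::_) measure)" by (rule borel_compact)
  have [measurable]: "h \<in> borel_measurable borel"
    unfolding h_def omega_III_def cal_J_def by measurable
  have hint: "set_integrable lborel phi_dom h"
    using h(1) unfolding set_integrable_def by (subst (asm) integrable_completion) auto
  then show "set_integrable lborel phi_dom (\<lambda>Y. rpoly_eval f Y * omega_III Y)"
    unfolding h_def .
  have "(LINT Y:phi_dom|lborel. h Y) = (LINT x:fund_dom|lborel. G x)"
    using set_borel_integral_eq_integral(2)[OF hint] set_borel_integral_eq_integral(2)[OF GintL] h(2) by simp
  then show "(LINT Y:phi_dom|lborel. rpoly_eval f Y * omega_III Y) = (LINT x:fund_dom|lborel. G x)"
    unfolding h_def .
qed

section \<open>One-dimensional quadrature\<close>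

lemma integrable_unit_interval:
  assumes "continuous_on UNIV (u :: real \<Rightarrow> real)"
  shows "set_integrable lborel {0..1} u"
  using borel_integrable_compact[of "{0..1}" u] continuous_on_subset[OF assms]
  by (simp add: set_integrable_def indicator_times_eq_if)

lemma integral_cos_multiple:
  fixes k :: int
  shows "(LINT x:{0..1}|lborel. cos (of_int k * (pi * x))) = (if k = 0 then 1 else 0)"
proof (cases "k = 0")
  case True
  then show ?thesis by (simp add: set_lebesgue_integral_def)
next
  case False
  have "(\<integral>x. cos (of_int k * (pi * x)) * indicator {0..1} x \<partial>lborel)
      = sin (of_int k * (pi * 1)) / (of_int k * pi) - sin (of_int k * (pi * 0)) / (of_int k * pi)"
    by (rule integral_FTC_Icc_real[where F = "\<lambda>x. sin (of_int k * (pi * x)) / (of_int k * pi)"])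
       (use False in \<open>auto intro!: derivative_eq_intros continuous_intros\<close>)
  then show ?thesis
    using False by (simp add: set_lebesgue_integral_def mult.commute sin_int_times_real sin_times_pi_eq_0)
qed

lemma cos_times_cos_multiple:
  fixes k :: int and x :: real
  shows "cos x * cos (of_int k * x) = (cos (of_int (k + 1) * x) + cos (of_int (k - 1) * x)) / 2"
proof -
  have "of_int (k + 1) * x = of_int k * x + x" "of_int (k - 1) * x = of_int k * x - x"
    by (simp_all add: algebra_simps)
  then show ?thesis by (simp only: cos_add cos_diff) simp
qed

text \<open>
  A rule that integrates the multiple angles up to \<open>D\<close> also integrates the powers of the cosine up to
  \<open>D\<close>: one factor \<open>cos x\<close> is traded for a shift of the frequency \<open>k\<close> by one in either direction. Integer
  frequencies avoid a special case at \<open>k = 0\<close>.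
\<close>

lemma quadrature_cos_power:
  fixes W t :: "'a \<Rightarrow> real" and k :: int
  assumes exact: "\<And>k::int. \<bar>k\<bar> \<le> D \<Longrightarrow> (\<Sum>r\<in>I. W r * cos (of_int k * (pi * t r))) = (if k = 0 then 1 else 0)"
  shows "int m + \<bar>k\<bar> \<le> D \<Longrightarrow>
    (\<Sum>r\<in>I. W r * (cos (pi * t r) ^ m * cos (of_int k * (pi * t r))))
      = (LINT x:{0..1}|lborel. cos (pi * x) ^ m * cos (of_int k * (pi * x)))"
proof (induction m arbitrary: k)
  case 0
  then show ?case using exact integral_cos_multiple[of k] by simp
next
  case (Suc m)
  let ?q = "\<lambda>k x. cos (pi * x) ^ m * cos (of_int k * (pi * x))"
  have split: "cos (pi * x) ^ Suc m * cos (of_int k * (pi * x)) = (?q (k + 1) x + ?q (k - 1) x) / 2" for x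
  proof -
    have "cos (pi * x) ^ Suc m * cos (of_int k * (pi * x)) = cos (pi * x) ^ m * (cos (pi * x) * cos (of_int k * (pi * x)))"
      by simp
    then show ?thesis unfolding cos_times_cos_multiple by (simp add: distrib_left)
  qed
  have int: "set_integrable lborel {0..1} (?q k)" for k
    by (intro integrable_unit_interval continuous_intros)
  have "(\<Sum>r\<in>I. W r * (cos (pi * t r) ^ Suc m * cos (of_int k * (pi * t r))))
      = ((\<Sum>r\<in>I. W r * ?q (k + 1) (t r)) + (\<Sum>r\<in>I. W r * ?q (k - 1) (t r))) / 2"
    unfolding split by (simp add: sum.distrib[symmetric] sum_divide_distrib distrib_left)
  also have "\<dots> = ((LINT x:{0..1}|lborel. ?q (k + 1) x) + (LINT x:{0..1}|lborel. ?q (k - 1) x)) / 2"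
    using Suc.prems by (simp only: Suc.IH[of "k + 1"] Suc.IH[of "k - 1"])
  also have "\<dots> = (LINT x:{0..1}|lborel. (?q (k + 1) x + ?q (k - 1) x) / 2)"
    by (simp only: set_integral_add(2)[OF int int, symmetric] set_integral_divide_zero)
  finally show ?case unfolding split .
qed

text \<open>
  The factor \<open>1 + cos x\<close> comes from \<open>J_III\<close> and costs one degree of exactness.
\<close>

lemma quadrature_weighted:
  fixes W t :: "'a \<Rightarrow> real"
  assumes exact: "\<And>k::int. \<bar>k\<bar> \<le> D \<Longrightarrow> (\<Sum>r\<in>I. W r * cos (of_int k * (pi * t r))) = (if k = 0 then 1 else 0)"
    and m: "int m + 1 \<le> D"
  shows "(\<Sum>r\<in>I. W r * (cos (pi * t r) ^ m * (1 + cos (pi * t r))))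
      = (LINT x:{0..1}|lborel. cos (pi * x) ^ m * (1 + cos (pi * x)))"
proof -
  have pow: "(\<Sum>r\<in>I. W r * cos (pi * t r) ^ j) = (LINT x:{0..1}|lborel. cos (pi * x) ^ j)" if "int j \<le> D" for j
    using quadrature_cos_power[where m = j and k = 0, OF exact] that by simp
  have int: "set_integrable lborel {0..1} (\<lambda>x. cos (pi * x) ^ j)" for j
    by (intro integrable_unit_interval continuous_intros)
  have "(\<Sum>r\<in>I. W r * (cos (pi * t r) ^ m * (1 + cos (pi * t r))))
      = (\<Sum>r\<in>I. W r * cos (pi * t r) ^ m) + (\<Sum>r\<in>I. W r * cos (pi * t r) ^ Suc m)"
    by (simp add: sum.distrib[symmetric] algebra_simps)
  also have "\<dots> = (LINT x:{0..1}|lborel. cos (pi * x) ^ m) + (LINT x:{0..1}|lborel. cos (pi * x) ^ Suc m)"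
    using m by (simp only: pow)
  also have "\<dots> = (LINT x:{0..1}|lborel. cos (pi * x) ^ m + cos (pi * x) ^ Suc m)"
    by (rule set_integral_add(2)[OF int int, symmetric])
  finally show ?thesis by (simp add: algebra_simps)
qed

text \<open>
  Multiplication by \<open>2 sin (\<theta> / 2)\<close> makes the sum of cosines telescope; the same holds for the shifted
  arguments below.
\<close>

lemma sum_cos_multiples: "2 * sin (\<theta> / 2) * (\<Sum>r<M. cos (real r * \<theta>)) = sin ((real M - 1 / 2) * \<theta>) + sin (\<theta> / 2)"
proof (induction M)
  case (Suc M)
  have "2 * sin (\<theta> / 2) * cos (real M * \<theta>) = sin ((real M + 1 / 2) * \<theta>) - sin ((real M - 1 / 2) * \<theta>)"
    by (simp add: distrib_right left_diff_distrib sin_add sin_diff)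
  then show ?case using Suc by (simp add: distrib_left algebra_simps)
qed simp

lemma sum_cos_half_multiples: "2 * sin (\<theta> / 2) * (\<Sum>r<M. cos ((real r + 1 / 2) * \<theta>)) = sin (real M * \<theta>)"
proof (induction M)
  case (Suc M)
  have "(real M + 1) * \<theta> = (real M + 1 / 2) * \<theta> + \<theta> / 2" "real M * \<theta> = (real M + 1 / 2) * \<theta> - \<theta> / 2"
    by (simp_all add: field_simps)
  then have "2 * sin (\<theta> / 2) * cos ((real M + 1 / 2) * \<theta>) = sin ((real M + 1) * \<theta>) - sin (real M * \<theta>)"
    by (simp only: sin_add sin_diff) (simp add: algebra_simps)
  then show ?case using Suc by (simp add: distrib_left add.commute)
qed simp

lemma sin_nonzero_small: "0 < \<bar>x\<bar> \<Longrightarrow> \<bar>x\<bar> < pi \<Longrightarrow> sin x \<noteq> 0"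
  using sin_gt_zero[of x] sin_gt_zero[of "- x"] by (cases "x > 0") auto

lemma sum_int_interval: "(\<Sum>r\<in>{0..int M - 1}. f r) = (\<Sum>r<M. f (int r))"
  by (rule sum.reindex_bij_witness[of _ int nat]) auto

lemma sin_int_pi_div_nonzero:
  fixes k :: int and c :: real
  assumes "real_of_int \<bar>k\<bar> < c" "k \<noteq> 0"
  shows "sin (of_int k * pi / c) \<noteq> 0"
proof (rule sin_nonzero_small)
  have "c > 0" using assms by linarith
  then show "\<bar>of_int k * pi / c\<bar> < pi" "0 < \<bar>of_int k * pi / c\<bar>"
    using assms by (simp_all add: abs_mult divide_simps)
qed

text \<open>
  The trapezoidal rule, with both endpoints included.
\<close>

lemma quadrature_III:
  fixes k :: int
  assumes M: "M > 0" and k: "\<bar>k\<bar> \<le> 2 * int M - 1"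
  shows "(\<Sum>r\<in>{0..int M}. c_weight (int M) r / M * cos (of_int k * (pi * (of_int r / M)))) = (if k = 0 then 1 else 0)"
proof -
  define \<theta> where "\<theta> = of_int k * pi / M"
  have arg: "of_int k * (pi * (of_int r / M)) = of_int r * \<theta>" for r by (simp add: \<theta>_def)
  have "(\<Sum>r\<in>{0..int M}. c_weight (int M) r / M * cos (of_int k * (pi * (of_int r / M))))
      = (\<Sum>r\<in>{0..int (Suc M) - 1}. c_weight (int M) r / M * cos (of_int r * \<theta>))"
    by (simp only: arg) simp
  also have "\<dots> = (\<Sum>r<M. c_weight (int M) (int r) / M * cos (real r * \<theta>)) + cos (M * \<theta>) / (2 * M)"
    by (subst sum_int_interval) (simp add: c_weight_def)
  also have "(\<Sum>r<M. c_weight (int M) (int r) / M * cos (real r * \<theta>))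
      = (\<Sum>r<M. cos (real r * \<theta>) / M - (if r = 0 then 1 / (2 * M) else 0))"
    by (intro sum.cong refl) (auto simp: c_weight_def)
  also have "\<dots> = (\<Sum>r<M. cos (real r * \<theta>)) / M - 1 / (2 * M)"
    using M by (simp add: sum_subtractf sum_divide_distrib)
  finally have eq: "(\<Sum>r\<in>{0..int M}. c_weight (int M) r / M * cos (of_int k * (pi * (of_int r / M))))
      = ((\<Sum>r<M. cos (real r * \<theta>)) - 1 / 2 + cos (M * \<theta>) / 2) / M"
    using M by (simp add: field_simps)
  show ?thesis
  proof (cases "k = 0")
    case True
    then show ?thesis using M unfolding eq by (simp add: \<theta>_def)
  next
    case False
    have s: "sin (\<theta> / 2) \<noteq> 0"
      using sin_int_pi_div_nonzero[of k "2 * M"] k False M by (simp add: \<theta>_def field_simps)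
    have "sin (M * \<theta>) = 0" using M by (simp add: \<theta>_def sin_times_pi_eq_0 mult.commute)
    then have "sin ((real M - 1 / 2) * \<theta>) = - cos (M * \<theta>) * sin (\<theta> / 2)"
      by (simp add: left_diff_distrib sin_diff)
    then have "2 * sin (\<theta> / 2) * ((\<Sum>r<M. cos (real r * \<theta>)) - 1 / 2 + cos (M * \<theta>) / 2) = 0"
      using sum_cos_multiples[of \<theta> M] by (simp add: algebra_simps)
    then show ?thesis using s False unfolding eq by simp
  qed
qed

lemma quadrature_IV:
  fixes k :: int
  assumes M: "M > 0" and k: "\<bar>k\<bar> \<le> 2 * int M - 1"
  shows "(\<Sum>r\<in>{0..int M - 1}. 1 / M * cos (of_int k * (pi * ((of_int r + 1 / 2) / M)))) = (if k = 0 then 1 else 0)"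
proof -
  define \<theta> where "\<theta> = of_int k * pi / M"
  have arg: "of_int k * (pi * ((of_int r + 1 / 2) / M)) = (of_int r + 1 / 2) * \<theta>" for r by (simp add: \<theta>_def)
  have eq: "(\<Sum>r\<in>{0..int M - 1}. 1 / M * cos (of_int k * (pi * ((of_int r + 1 / 2) / M))))
      = (\<Sum>r<M. cos ((real r + 1 / 2) * \<theta>)) / M"
    unfolding arg sum_int_interval by (simp add: sum_divide_distrib)
  show ?thesis
  proof (cases "k = 0")
    case True
    then show ?thesis using M unfolding eq by (simp add: \<theta>_def)
  next
    case False
    have s: "sin (\<theta> / 2) \<noteq> 0"
      using sin_int_pi_div_nonzero[of k "2 * M"] k False M by (simp add: \<theta>_def field_simps)
    have "sin (M * \<theta>) = 0" using M by (simp add: \<theta>_def sin_times_pi_eq_0 mult.commute)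
    then show ?thesis using s False sum_cos_half_multiples[of \<theta> M] unfolding eq by simp
  qed
qed

text \<open>
  By symmetry, this is the sum over all \<open>2 M - 1\<close> equidistant nodes of a full period, which annihilates
  the frequencies that are not divisible by \<open>2 M - 1\<close>.
\<close>

lemma quadrature_VII:
  fixes k :: int
  assumes M: "M > 0" and k: "\<bar>k\<bar> \<le> 2 * int M - 2"
  shows "(\<Sum>r\<in>{0..int M - 1}. 2 / (2 * real M - 1) * c_weight (int M) r * cos (of_int k * (pi * (2 * of_int r / (2 * real M - 1)))))
     = (if k = 0 then 1 else 0)"
proof -
  define L where "L = 2 * real M - 1"
  have L: "L > 0" using M by (simp add: L_def)
  define \<theta> where "\<theta> = 2 * of_int k * pi / L"
  have arg: "of_int k * (pi * (2 * of_int r / L)) = of_int r * \<theta>" for r by (simp add: \<theta>_def)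
  have "(\<Sum>r\<in>{0..int M - 1}. 2 / L * c_weight (int M) r * cos (of_int k * (pi * (2 * of_int r / L))))
      = (\<Sum>r<M. 2 / L * cos (real r * \<theta>) - (if r = 0 then 1 / L else 0))"
    unfolding arg sum_int_interval by (intro sum.cong refl) (auto simp: c_weight_def)
  also have "\<dots> = (2 * (\<Sum>r<M. cos (real r * \<theta>)) - 1) / L"
    by (simp only: sum_subtractf sum_distrib_left[symmetric]) (use M in \<open>simp add: diff_divide_distrib\<close>)
  finally have eq: "(\<Sum>r\<in>{0..int M - 1}. 2 / L * c_weight (int M) r * cos (of_int k * (pi * (2 * of_int r / L))))
      = (2 * (\<Sum>r<M. cos (real r * \<theta>)) - 1) / L" .
  have "(2 * (\<Sum>r<M. cos (real r * \<theta>)) - 1) / L = (if k = 0 then 1 else 0)"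
  proof (cases "k = 0")
    case True
    then show ?thesis using L by (simp add: \<theta>_def) (simp add: L_def)
  next
    case False
    have "real_of_int \<bar>k\<bar> < L" using k unfolding L_def by linarith
    then have s: "sin (\<theta> / 2) \<noteq> 0"
      using sin_int_pi_div_nonzero[of k L] False by (simp add: \<theta>_def)
    have "(real M - 1 / 2) * \<theta> = of_int k * pi" using L by (simp add: \<theta>_def L_def field_simps)
    then have "sin ((real M - 1 / 2) * \<theta>) = 0" by (simp only: sin_times_pi_eq_0) simp
    then have "sin (\<theta> / 2) * (2 * (\<Sum>r<M. cos (real r * \<theta>)) - 1) = 0"
      using sum_cos_multiples[of \<theta> M] by (simp add: algebra_simps)
    then show ?thesis using s False by simp
  qed
  then show ?thesis using eq unfolding L_def by simp
qed

section \<open>Product quadrature and cubature on the fundamental domain\<close>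

lemma continuous_coord_poly: "coord_poly d h \<Longrightarrow> continuous_on S h"
  by (induction rule: coord_poly.induct) (auto intro!: continuous_intros)

lemma continuous_cos_vec: "continuous_on S cos_vec"
  unfolding cos_vec_def[abs_def] by (intro continuous_intros)

lemma sum_labels_prod:
  fixes u :: "'n::finite \<Rightarrow> 'b \<Rightarrow> real"
  assumes "finite I"
  shows "(\<Sum>r | \<forall>i. r $ i \<in> I. \<Prod>i\<in>UNIV. u i (r $ i)) = (\<Prod>i\<in>UNIV. \<Sum>a\<in>I. u i a)"
proof -
  have "(\<Sum>r | \<forall>i. r $ i \<in> I. \<Prod>i\<in>UNIV. u i (r $ i)) = (\<Sum>g\<in>PiE UNIV (\<lambda>_. I). \<Prod>i\<in>UNIV. u i (g i))"
    by (rule sum.reindex_bij_witness[of _ vec_lambda vec_nth]) auto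
  then show ?thesis using assms by (simp add: prod_sum_PiE)
qed

lemma set_integral_cube_prod:
  fixes u :: "'n::{finite,wellorder} \<Rightarrow> real \<Rightarrow> real"
  assumes "\<And>i. continuous_on UNIV (u i)"
  shows "(LINT x:cbox 0 1|lborel. \<Prod>i\<in>UNIV. u i (x $ i)) = (\<Prod>i\<in>UNIV. LINT x:{0..1}|lborel. u i x)"
proof -
  have ind: "indicator (cbox 0 1) x *\<^sub>R (\<Prod>i\<in>UNIV. u i (x $ i)) = (\<Prod>i\<in>UNIV. indicator {0..1} (x $ i) *\<^sub>R u i (x $ i))"
    for x :: "real^'n::_"
  proof -
    have "indicator (cbox 0 1) x = (\<Prod>i\<in>UNIV. indicator {0..1} (x $ i) :: real)"
      by (auto simp: indicator_def mem_box_cart prod_zero_iff)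
    then show ?thesis by (simp add: prod.distrib)
  qed
  show ?thesis
    unfolding set_lebesgue_integral_def ind
    by (rule integral_lborel_prod_cart) (use integrable_unit_interval[OF assms] in \<open>simp add: set_integrable_def\<close>)
qed

text \<open>
  On monomials both sides factor into one-dimensional expressions.
\<close>

lemma product_quadrature:
  fixes W t :: "'b \<Rightarrow> real" and h :: "real^'n::{finite,wellorder} \<Rightarrow> real"
  assumes fin: "finite I"
    and exact: "\<And>m. m \<le> d \<Longrightarrow> (\<Sum>r\<in>I. W r * (cos (pi * t r) ^ m * (1 + cos (pi * t r))))
      = (LINT x:{0..1}|lborel. cos (pi * x) ^ m * (1 + cos (pi * x)))"
    and h: "coord_poly d h"
  shows "(LINT x:cbox 0 1|lborel. h (cos_vec x) * (\<Prod>i\<in>UNIV. 1 + cos_vec x $ i))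
     = (\<Sum>r | \<forall>i. r $ i \<in> I. (\<Prod>i\<in>UNIV. W (r $ i)) *
          (h (cos_vec (\<chi> i. t (r $ i))) * (\<Prod>i\<in>UNIV. 1 + cos_vec (\<chi> i. t (r $ i)) $ i)))"
  using h
proof (induction rule: coord_poly.induct)
  case (coord_poly_monom m a)
  let ?u = "\<lambda>i x. cos (pi * x) ^ m i * (1 + cos (pi * x))"
  have "(LINT x:cbox 0 1|lborel. a * (\<Prod>i\<in>UNIV. cos_vec x $ i ^ m i) * (\<Prod>i\<in>UNIV. 1 + cos_vec x $ i))
      = (LINT x:cbox 0 1|lborel. a * (\<Prod>i\<in>(UNIV::'n set). ?u i (x $ i)))"
    by (simp add: cos_vec_def prod.distrib mult.assoc)
  also have "\<dots> = a * (\<Prod>i\<in>(UNIV::'n set). LINT x:{0..1}|lborel. ?u i x)"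
    by (subst set_integral_mult_right, subst set_integral_cube_prod) (auto intro!: continuous_intros)
  also have "\<dots> = a * (\<Prod>i\<in>(UNIV::'n set). \<Sum>r\<in>I. W r * ?u i (t r))"
    using exact coord_poly_monom by simp
  also have "\<dots> = (\<Sum>r::'b^'n::_ | \<forall>i. r $ i \<in> I. a * (\<Prod>i\<in>UNIV. W (r $ i) * ?u i (t (r $ i))))"
    by (simp add: sum_labels_prod[OF fin, symmetric] sum_distrib_left)
  finally show ?case
    by (simp add: cos_vec_def prod.distrib mult_ac)
next
  case (coord_poly_add g h)
  have int: "set_integrable lborel (cbox 0 1) (\<lambda>x. g (cos_vec x) * (\<Prod>i\<in>UNIV. 1 + cos_vec x $ i))"
    if "coord_poly d g" for g :: "real^'n::_ \<Rightarrow> real"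
  proof -
    have "continuous_on (cbox 0 1) (\<lambda>x. g (cos_vec x) * (\<Prod>i\<in>UNIV. 1 + cos_vec x $ i))"
      by (intro continuous_intros continuous_cos_vec
          continuous_on_compose2[OF continuous_coord_poly[OF that, of UNIV] continuous_cos_vec]) auto
    from borel_integrable_compact[OF compact_cbox this] show ?thesis
      by (simp add: set_integrable_def indicator_times_eq_if)
  qed
  show ?case
    unfolding distrib_right distrib_left sum.distrib coord_poly_add.IH[symmetric]
    by (rule set_integral_add(2)[OF int int]) (use coord_poly_add.hyps in auto)
qed

lemma coord_poly_esym: "coord_poly 1 (\<lambda>y. esym A y k)"
  unfolding esym_def
proof (rule coord_poly_sum)
  fix S :: "'a set"
  have "(\<Prod>i\<in>UNIV. y $ i ^ (if i \<in> S then 1 else 0)) = (\<Prod>i\<in>S. y $ i)" for y :: "real^'a"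
    by (simp add: if_distrib[of "(^) _"] prod.If_cases cong: if_cong)
  then show "coord_poly 1 (\<lambda>y. \<Prod>i\<in>S. y $ i)"
    using coord_poly_monom[of "\<lambda>i. if i \<in> S then 1 else 0" 1 1] by simp
qed

text \<open>
  Both sides, multiplied by \<open>n!\<close>, are the corresponding expressions over the whole cube, because the
  integrand is symmetric; there the product rule applies.
\<close>

lemma cubature:
  fixes W t :: "'b \<Rightarrow> real" and f :: "('n::{finite,wellorder}) rpoly"
  assumes fin: "finite I" and t: "\<And>a. a \<in> I \<Longrightarrow> 0 \<le> t a \<and> t a \<le> 1"
    and exact: "\<And>m. m \<le> rpoly_degree f \<Longrightarrow> (\<Sum>r\<in>I. W r * (cos (pi * t r) ^ m * (1 + cos (pi * t r))))
      = (LINT x:{0..1}|lborel. cos (pi * x) ^ m * (1 + cos (pi * x)))"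
  defines "G \<equiv> \<lambda>x. rpoly_eval f (phi x) * (cos_plus (\<chi> i. 1 / 2) x)\<^sup>2"
    and "pt \<equiv> \<lambda>r::'b^'n::_. \<chi> i. t (r $ i)"
  shows "(LINT x:fund_dom|lborel. G x)
     = (\<Sum>r | (\<forall>i. r $ i \<in> I) \<and> pt r \<in> fund_dom. (\<Prod>i\<in>UNIV. W (r $ i)) * G (pt r) / stab_card (pt r))"
proof -
  define h where "h y = rpoly_eval f (\<chi> j. real (X_factor j) * esym UNIV y (card {..j})) * ((fact CARD('n))\<^sup>2 / 2 ^ CARD('n))" for y :: "real^'n::_"
  have h: "coord_poly (rpoly_degree f) h"
  proof -
    have "coord_poly (0 + 1) (\<lambda>y. real (X_factor j) * esym UNIV y (card {..j}))" for j :: 'n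
      by (intro coord_poly_mult coord_poly_const coord_poly_esym)
    then have "coord_poly (rpoly_degree f + 0) h"
      unfolding h_def by (intro coord_poly_mult coord_poly_const coord_poly_rpoly_comp) simp
    then show ?thesis by simp
  qed
  have G: "G x = h (cos_vec x) * (\<Prod>i\<in>UNIV. 1 + cos_vec x $ i)" for x
    by (simp add: G_def h_def cos_rho_square phi_def X_var_esym prod_dividef)
  have sym: "G (permute_vec \<sigma> x) = G x" if "\<sigma> permutes UNIV" for \<sigma> x
    using that by (simp add: G_def phi_permute cos_plus_permute)
  have cont: "continuous_on UNIV G"
    unfolding G by (intro continuous_intros continuous_cos_vec
          continuous_on_compose2[OF continuous_coord_poly[OF h, of UNIV] continuous_cos_vec]) auto
  have pt_perm: "pt (permute_vec \<sigma> r) = permute_vec \<sigma> (pt r)" for \<sigma> r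
    by (simp add: pt_def vec_eq_iff)
  have symW: "(\<Prod>i\<in>UNIV. W (permute_vec \<sigma> r $ i)) = (\<Prod>i\<in>UNIV. W (r $ i))"
    if "\<sigma> permutes UNIV" for \<sigma> :: "'n \<Rightarrow> 'n" and r
    using prod.permute[OF that, of "\<lambda>i. W (r $ i)"] by (simp add: comp_def)
  have "fact CARD('n) * (LINT x:fund_dom|lborel. G x) = (LINT x:cbox 0 1|lborel. G x)"
    using integral_cube_symmetric[OF cont sym] by simp
  also have "\<dots> = (\<Sum>r | \<forall>i. r $ i \<in> I. (\<Prod>i\<in>UNIV. W (r $ i)) * G (pt r))"
    unfolding G pt_def by (rule product_quadrature[OF fin exact h])
  also have "\<dots> = fact CARD('n) * (\<Sum>r | (\<forall>i. r $ i \<in> I) \<and> pt r \<in> fund_dom. (\<Prod>i\<in>UNIV. W (r $ i)) * G (pt r) / stab_card (pt r))"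
    unfolding pt_def
  proof (rule sum_labels_symmetric[OF fin t])
    fix \<sigma> :: "'n \<Rightarrow> 'n" and r :: "'b^'n::_" assume "\<sigma> permutes UNIV"
    then show "(\<Prod>i\<in>UNIV. W (permute_vec \<sigma> r $ i)) * G (\<chi> i. t (permute_vec \<sigma> r $ i))
        = (\<Prod>i\<in>UNIV. W (r $ i)) * G (\<chi> i. t (r $ i))"
      using pt_perm unfolding pt_def by (simp only: symW sym)
  qed
  finally show ?thesis by simp
qed

lemma D_plus_alt:
  fixes t :: "int \<Rightarrow> real"
  assumes t: "strict_mono t" and I: "\<And>a. a \<in> {0..N - 1} \<Longrightarrow> 0 \<le> t a \<and> t a \<le> 1"
  shows "D_plus N = {r::int^'n::{finite,wellorder}. (\<forall>i. r $ i \<in> {0..N - 1}) \<and> (\<chi> i. t (r $ i)) \<in> fund_dom}"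
  using I by (auto simp: D_plus_def fund_dom_def strict_mono_less_eq[OF t])

text \<open>
  The function \<open>F\<close> stands for the label weights as read off from the image points. Its hypothesis may
  use the injectivity of the parametrization, without which a label could not be recovered.
\<close>

lemma cubature_phi_grid:
  fixes e t :: "int \<Rightarrow> real" and f :: "('n::{finite,wellorder}) rpoly"
    and pt :: "int \<Rightarrow> int^'n::_ \<Rightarrow> real^'n::_"
  assumes pt: "\<And>r. pt N r = (\<chi> i. t (r $ i))"
    and t: "strict_mono t" and I: "\<And>a. a \<in> {0..N - 1} \<Longrightarrow> 0 \<le> t a \<and> t a \<le> 1"
    and exact: "\<And>m. m \<le> rpoly_degree f \<Longrightarrow>
      (\<Sum>r\<in>{0..N - 1}. w * e r * (cos (pi * t r) ^ m * (1 + cos (pi * t r))))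
      = (LINT x:{0..1}|lborel. cos (pi * x) ^ m * (1 + cos (pi * x)))"
    and F: "\<And>r. r \<in> D_plus N \<Longrightarrow> inj_on (\<lambda>r. phi (pt N r)) (D_plus N) \<Longrightarrow> F (phi (pt N r)) = (\<Prod>i\<in>UNIV. e (r $ i))"
  shows "(LINT Y:phi_dom|lborel. rpoly_eval f Y * omega_III Y)
    = w ^ CARD('n) * (\<Sum>Y\<in>phi_grid pt N. F Y * inverse (H_coeff Y) * rpoly_eval f Y * rpoly_eval J_III Y)"
proof -
  let ?D = "D_plus N :: (int^'n::_) set"
  have D: "?D = {r. (\<forall>i. r $ i \<in> {0..N - 1}) \<and> pt N r \<in> fund_dom}"
    unfolding pt by (rule D_plus_alt[OF t I])
  have inF: "pt N r \<in> fund_dom" if "r \<in> ?D" for r using that D by auto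
  have inj_pt: "inj (pt N)"
    using strict_mono_eq[OF t] by (auto simp: inj_def pt vec_eq_iff)
  have inj: "inj_on (\<lambda>r. phi (pt N r)) ?D"
  proof (rule inj_onI)
    fix r s assume "r \<in> ?D" "s \<in> ?D" "phi (pt N r) = phi (pt N s)"
    then have "pt N r = pt N s" using inj_onD[OF inj_on_phi] inF by blast
    then show "r = s" by (rule injD[OF inj_pt])
  qed
  have H: "H_coeff (phi (pt N r)) = stab_card (pt N r)" if "r \<in> ?D" for r
    by (simp add: H_coeff_def the_inv_into_f_f[OF inj_on_phi inF[OF that]])
  have "(LINT Y:phi_dom|lborel. rpoly_eval f Y * omega_III Y)
     = (\<Sum>r\<in>?D. (\<Prod>i\<in>UNIV. w * e (r $ i)) * (rpoly_eval f (phi (pt N r)) * (cos_plus (\<chi> i. 1 / 2) (pt N r))\<^sup>2) / stab_card (pt N r))"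
    unfolding integral_phi_dom(2) D pt by (rule cubature) (use I exact in auto)
  also have "\<dots> = (\<Sum>r\<in>?D. w ^ CARD('n) * (F (phi (pt N r)) * inverse (H_coeff (phi (pt N r)))
      * rpoly_eval f (phi (pt N r)) * rpoly_eval J_III (phi (pt N r))))"
    by (intro sum.cong refl) (simp add: F inj H J_III_phi inF prod.distrib field_simps)
  also have "\<dots> = w ^ CARD('n) * (\<Sum>Y\<in>(\<lambda>r. phi (pt N r)) ` ?D. F Y * inverse (H_coeff Y) * rpoly_eval f Y * rpoly_eval J_III Y)"
    by (simp add: sum.reindex[OF inj] sum_distrib_left)
  finally show ?thesis
    by (simp add: phi_grid_def grid_def image_image)
qed

lemma E_coeff_phi:
  assumes "r \<in> D_plus N" "inj_on (\<lambda>r. phi (pt N r)) (D_plus N)"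
  shows "E_coeff pt N (phi (pt N r)) = (\<Prod>i\<in>UNIV. c_weight N (r $ i))"
  unfolding E_coeff_def by (simp add: the_inv_into_f_f[OF assms(2,1)])

lemma cubature_III:
  fixes f :: "('n::{finite,wellorder}) rpoly"
  assumes N: "N \<ge> 2" and deg: "int (rpoly_degree f) \<le> 2 * (N - 1)"
  shows "(LINT Y:phi_dom|lborel. rpoly_eval f Y * omega_III Y) =
    (1 / real_of_int N) ^ CARD('n) *
      (\<Sum>Y\<in>phi_grid pt_III N. E_coeff pt_III N Y * inverse (H_coeff Y) * rpoly_eval f Y * rpoly_eval J_III Y)"
proof (rule cubature_phi_grid[where t = "\<lambda>r. of_int r / of_int N" and e = "c_weight N"])
  define M where "M = nat N"
  have M: "M > 0" "N = int M" using N by (auto simp: M_def)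
  fix m assume m: "m \<le> rpoly_degree f"
  let ?g = "\<lambda>r. c_weight (int M) r / M * (cos (pi * (of_int r / M)) ^ m * (1 + cos (pi * (of_int r / M))))"
  have "(\<Sum>r\<in>{0..int M}. ?g r) = (LINT x:{0..1}|lborel. cos (pi * x) ^ m * (1 + cos (pi * x)))"
    by (rule quadrature_weighted[where D = "2 * int M - 1", OF quadrature_III])
       (use m deg M in auto)
  \<comment> \<open>The right endpoint of the trapezoidal rule is not in the grid, but there \<open>1 + cos\<close> vanishes.\<close>
  moreover have "{0..int M} = insert (int M) {0..int M - 1}" using M by auto
  ultimately show "(\<Sum>r\<in>{0..N - 1}. 1 / of_int N * c_weight N r * (cos (pi * (of_int r / of_int N)) ^ m * (1 + cos (pi * (of_int r / of_int N)))))
      = (LINT x:{0..1}|lborel. cos (pi * x) ^ m * (1 + cos (pi * x)))"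
    using M by simp
next
  show "strict_mono (\<lambda>r. real_of_int r / real_of_int N)"
    using N by (auto simp: strict_mono_def divide_strict_right_mono)
next
  fix a assume "a \<in> {0..N - 1}"
  then show "0 \<le> real_of_int a / real_of_int N \<and> real_of_int a / real_of_int N \<le> 1"
    using N by auto
qed (simp add: pt_III_def, rule E_coeff_phi)

lemma cubature_IV:
  fixes f :: "('n::{finite,wellorder}) rpoly"
  assumes N: "N \<ge> 2" and deg: "int (rpoly_degree f) \<le> 2 * (N - 1)"
  shows "(LINT Y:phi_dom|lborel. rpoly_eval f Y * omega_III Y) =
    (1 / real_of_int N) ^ CARD('n) *
      (\<Sum>Y\<in>phi_grid pt_IV N. inverse (H_coeff Y) * rpoly_eval f Y * rpoly_eval J_III Y)"
proof -
  have "(LINT Y:phi_dom|lborel. rpoly_eval f Y * omega_III Y) =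
    (1 / real_of_int N) ^ CARD('n) *
      (\<Sum>Y\<in>phi_grid pt_IV N. 1 * inverse (H_coeff Y) * rpoly_eval f Y * rpoly_eval J_III Y)"
  proof (rule cubature_phi_grid[where t = "\<lambda>r. (of_int r + 1 / 2) / of_int N" and e = "\<lambda>_. 1"])
    define M where "M = nat N"
    have M: "M > 0" "N = int M" using N by (auto simp: M_def)
    fix m assume m: "m \<le> rpoly_degree f"
    have "(\<Sum>r\<in>{0..int M - 1}. 1 / M * (cos (pi * ((of_int r + 1 / 2) / M)) ^ m * (1 + cos (pi * ((of_int r + 1 / 2) / M)))))
      = (LINT x:{0..1}|lborel. cos (pi * x) ^ m * (1 + cos (pi * x)))"
      by (rule quadrature_weighted[where D = "2 * int M - 1", OF quadrature_IV])
         (use m deg M in auto)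
    then show "(\<Sum>r\<in>{0..N - 1}. 1 / of_int N * 1 * (cos (pi * ((of_int r + 1 / 2) / of_int N)) ^ m * (1 + cos (pi * ((of_int r + 1 / 2) / of_int N)))))
        = (LINT x:{0..1}|lborel. cos (pi * x) ^ m * (1 + cos (pi * x)))"
      using M by simp
  next
    fix a assume "a \<in> {0..N - 1}"
    then have "0 \<le> real_of_int a" "real_of_int a + 1 \<le> real_of_int N" by auto
    then show "0 \<le> (of_int a + 1 / 2) / real_of_int N \<and> (of_int a + 1 / 2) / real_of_int N \<le> 1"
      using N by (auto simp: divide_simps)
  next
    show "strict_mono (\<lambda>r. (real_of_int r + 1 / 2) / real_of_int N)"
      using N by (auto simp: strict_mono_def divide_strict_right_mono)
  qed (simp_all add: pt_IV_def)
  then show ?thesis by simp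
qed

lemma cubature_VII:
  fixes f :: "('n::{finite,wellorder}) rpoly"
  assumes N: "N \<ge> 2" and deg: "int (rpoly_degree f) \<le> 2 * (N - 1) - 1"
  shows "(LINT Y:phi_dom|lborel. rpoly_eval f Y * omega_III Y) =
    (2 / (2 * real_of_int N - 1)) ^ CARD('n) *
      (\<Sum>Y\<in>phi_grid pt_VII N. E_coeff pt_VII N Y * inverse (H_coeff Y) * rpoly_eval f Y * rpoly_eval J_III Y)"
proof (rule cubature_phi_grid[where t = "\<lambda>r. 2 * of_int r / (2 * of_int N - 1)" and e = "c_weight N"])
  define M where "M = nat N"
  have M: "M > 0" "N = int M" using N by (auto simp: M_def)
  fix m assume m: "m \<le> rpoly_degree f"
  have "(\<Sum>r\<in>{0..int M - 1}. 2 / (2 * real M - 1) * c_weight (int M) r *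
      (cos (pi * (2 * of_int r / (2 * real M - 1))) ^ m * (1 + cos (pi * (2 * of_int r / (2 * real M - 1))))))
    = (LINT x:{0..1}|lborel. cos (pi * x) ^ m * (1 + cos (pi * x)))"
    by (rule quadrature_weighted[where D = "2 * int M - 2", OF quadrature_VII])
       (use m deg M in auto)
  then show "(\<Sum>r\<in>{0..N - 1}. 2 / (2 * of_int N - 1) * c_weight N r *
      (cos (pi * (2 * of_int r / (2 * of_int N - 1))) ^ m * (1 + cos (pi * (2 * of_int r / (2 * of_int N - 1))))))
      = (LINT x:{0..1}|lborel. cos (pi * x) ^ m * (1 + cos (pi * x)))"
    using M by simp
next
  fix a assume "a \<in> {0..N - 1}"
  then have "0 \<le> real_of_int a" "real_of_int a + 1 \<le> real_of_int N" by auto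
  then show "0 \<le> 2 * of_int a / (2 * real_of_int N - 1) \<and> 2 * of_int a / (2 * real_of_int N - 1) \<le> 1"
    using N by (auto simp: divide_simps)
next
  show "strict_mono (\<lambda>r. 2 * real_of_int r / (2 * real_of_int N - 1))"
    using N by (auto simp: strict_mono_def divide_strict_right_mono)
qed (simp add: pt_VII_def, rule E_coeff_phi)

theorem mainTheorem14:
  shows "(\<forall>(N::int) (f::('n::{finite,wellorder}) rpoly).
            N \<ge> 2 \<and> int (rpoly_degree f) \<le> 2 * (N - 1) \<longrightarrow>
              set_integrable lborel phi_dom (\<lambda>Y. rpoly_eval f Y * omega_III Y) \<and>
              (LINT Y:phi_dom|lborel. rpoly_eval f Y * omega_III Y) =
                (1 / real_of_int N) ^ CARD('n) *
                (\<Sum>Y\<in>phi_grid pt_III N.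
                   E_coeff pt_III N Y * inverse (H_coeff Y) * rpoly_eval f Y * rpoly_eval J_III Y) \<and>
              (LINT Y:phi_dom|lborel. rpoly_eval f Y * omega_III Y) =
                (1 / real_of_int N) ^ CARD('n) *
                (\<Sum>Y\<in>phi_grid pt_IV N.
                   inverse (H_coeff Y) * rpoly_eval f Y * rpoly_eval J_III Y))
       \<and> (\<forall>(N::int) (f::'n rpoly).
            N \<ge> 2 \<and> int (rpoly_degree f) \<le> 2 * (N - 1) - 1 \<longrightarrow>
              set_integrable lborel phi_dom (\<lambda>Y. rpoly_eval f Y * omega_III Y) \<and>
              (LINT Y:phi_dom|lborel. rpoly_eval f Y * omega_III Y) =
                (2 / (2 * real_of_int N - 1)) ^ CARD('n) *
                (\<Sum>Y\<in>phi_grid pt_VII N.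
                   E_coeff pt_VII N Y * inverse (H_coeff Y) * rpoly_eval f Y * rpoly_eval J_III Y))"
  by (intro conjI allI impI integral_phi_dom(1) cubature_III cubature_IV cubature_VII) auto

end
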